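(* Let $\alpha$, $\mathcal T$, $\mathcal C$ be as in the context. The ideal $\mathcal I^\infty$ of $\infty$-$\mathcal C$-phantom maps in $\mathcal T$ is a square zero ideal, $(\mathcal I^\infty)^2=0$; that is, if $h\colon X\to Y$ and $k\colon Y\to Z$ are $\infty$-$\mathcal C$-phantom maps in $\mathcal T$, then $kh=0$.
   Context: Let $\alpha$ be a (infinite) regular cardinal. In a triangulated category $\mathcal T$ with coproducts and suspension $\Sigma$, an object $S$ is $\alpha$-small if any morphism $S\to\coprod_{i\in I}X_i$ factors through $\coprod_{i\in I'}X_i$ for some $I'\subset I$ with $\mathrm{card}\,I'<\alpha$. A class $\mathcal S$ of objects generates $\mathcal T$ if an object $X$ is zero if and only if $\mathcal T(S,X)=0$ for all $S\in\mathcal S$. It is perfect if, for every set $\{f_i\colon X_i\to Y_i\}_{i\in I}$ of morphisms such that $\mathcal T(S,f_i)$ is surjective for all $i$ and all $S\in\mathcal S$, the map $\mathcal T(S,\coprod_i f_i)$ is surjective for all $S\in\mathcal S$. $\mathcal T$ is $\alpha$-compactly generated if it has a perfect generating set of $\alpha$-small objects, and well generated if it is so for some regular $\alpha$. $\mathcal T^\alpha$ is the unique maximal full subcategory of $\mathcal T$ formed by $\alpha$-small objects such that any morphism $S\to\coprod_{i\in I}X_i$ with $S\in\mathcal T^\alpha$ factors through a coproduct $\coprod f_i\colon\coprod_i S_i\to\coprod_i X_i$ with all $S_i\in\mathcal T^\alpha$. Standing assumptions: $\mathcal T$ is a non-zero well generated triangulated category and $\mathcal C\subset\mathcal T^\alpha$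 is a non-zero essentially small full subcategory of $\mathcal T$ which is closed under suspension and desuspension, has coproducts of fewer than $\alpha$ objects (computed in $\mathcal T$), generates $\mathcal T$, and is perfect. A morphism $f\colon X\to Y$ in $\mathcal T$ is a $\mathcal C$-phantom map if $\mathcal T(C,f)=0$ for all $C$ in $\mathcal C$. It is an $n$-$\mathcal C$-phantom map if $f=f_1\cdots f_n$ is a composite of $n$ $\mathcal C$-phantom maps, and an $\infty$-$\mathcal C$-phantom map if it is an $n$-$\mathcal C$-phantom map for all $n>0$. *)

theory Defs
  imports "HOL-Algebra.Group"
begin

unbundle cardinal_syntax

section \<open>Small sets\<close>

text \<open>
  The objects and the arrows of a category with coproducts form classes, its hom-sets and the
  families of which coproducts are taken are sets.  This distinction is made relative to an
  inaccessible cardinal \<open>\<kappa>\<close>: the sets of the theory are those of cardinality less than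
  \<open>\<kappa>\<close>, and a class is a set of arbitrary size.  As every small set is in bijection with
  a subset of the type \<open>'u\<close> underlying \<open>\<kappa>\<close>, index sets can be taken in \<open>'u\<close>.
\<close>

definition inaccessible :: "'u rel \<Rightarrow> bool" where
  "inaccessible \<kappa> \<longleftrightarrow>
     Card_order \<kappa> \<and> natLeq <o \<kappa> \<and> regularCard \<kappa> \<and>
     (\<forall>A::'u set. |A| <o \<kappa> \<longrightarrow> |Pow A| <o \<kappa>)"

text \<open>An infinite regular cardinal which is itself a small set.\<close>

definition small_regular_cardinal :: "'u rel \<Rightarrow> 'u rel \<Rightarrow> bool" where
  "small_regular_cardinal \<kappa> \<alpha> \<longleftrightarrow> Cinfinite \<alpha> \<and> regularCard \<alpha> \<and> \<alpha> <o \<kappa>"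


section \<open>Categories\<close>

record ('o, 'm) category =
  Obj :: "'o set"
  Arr :: "'m set"
  Dom :: "'m \<Rightarrow> 'o"
  Cod :: "'m \<Rightarrow> 'o"
  Ide :: "'o \<Rightarrow> 'm"
  Comp :: "'m \<Rightarrow> 'm \<Rightarrow> 'm" (infixl "\<cdot>\<index>" 70)

definition Hom :: "('o, 'm, 'x) category_scheme \<Rightarrow> 'o \<Rightarrow> 'o \<Rightarrow> 'm set" where
  "Hom T X Y = {f \<in> Arr T. Dom T f = X \<and> Cod T f = Y}"

locale category =
  fixes T :: "('o, 'm, 'x) category_scheme" (structure)
  assumes dom_obj: "f \<in> Arr T \<Longrightarrow> Dom T f \<in> Obj T"
    and cod_obj: "f \<in> Arr T \<Longrightarrow> Cod T f \<in> Obj T"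
    and ide_hom: "X \<in> Obj T \<Longrightarrow> Ide T X \<in> Hom T X X"
    and comp_hom: "\<lbrakk>f \<in> Hom T X Y; g \<in> Hom T Y Z\<rbrakk> \<Longrightarrow> g \<cdot> f \<in> Hom T X Z"
    and comp_ide_right: "f \<in> Hom T X Y \<Longrightarrow> f \<cdot> Ide T X = f"
    and comp_ide_left: "f \<in> Hom T X Y \<Longrightarrow> Ide T Y \<cdot> f = f"
    and comp_assoc:
      "\<lbrakk>f \<in> Hom T W X; g \<in> Hom T X Y; h \<in> Hom T Y Z\<rbrakk> \<Longrightarrow> (h \<cdot> g) \<cdot> f = h \<cdot> (g \<cdot> f)"

definition locally_small :: "('o, 'm, 'x) category_scheme \<Rightarrow> 'u rel \<Rightarrow> bool" where
  "locally_small T \<kappa> \<longleftrightarrow> (\<forall>X\<in>Obj T. \<forall>Y\<in>Obj T. |Hom T X Y| <o \<kappa>)"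

definition iso_arr :: "('o, 'm, 'x) category_scheme \<Rightarrow> 'm \<Rightarrow> bool" where
  "iso_arr T f \<longleftrightarrow> f \<in> Arr T \<and>
     (\<exists>g \<in> Hom T (Cod T f) (Dom T f).
        g \<cdot>\<^bsub>T\<^esub> f = Ide T (Dom T f) \<and> f \<cdot>\<^bsub>T\<^esub> g = Ide T (Cod T f))"

definition iso_obj :: "('o, 'm, 'x) category_scheme \<Rightarrow> 'o \<Rightarrow> 'o \<Rightarrow> bool" where
  "iso_obj T X Y \<longleftrightarrow> (\<exists>f \<in> Hom T X Y. iso_arr T f)"

definition zero_obj :: "('o, 'm, 'x) category_scheme \<Rightarrow> 'o \<Rightarrow> bool" where
  "zero_obj T Z \<longleftrightarrow> Z \<in> Obj T \<and>
     (\<forall>X\<in>Obj T. (\<exists>!f. f \<in> Hom T Z X) \<and> (\<exists>!f. f \<in> Hom T X Z))"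

definition is_coproduct ::
  "('o, 'm, 'x) category_scheme \<Rightarrow> 'i set \<Rightarrow> ('i \<Rightarrow> 'o) \<Rightarrow> 'o \<Rightarrow> ('i \<Rightarrow> 'm) \<Rightarrow> bool" where
  "is_coproduct T I X P p \<longleftrightarrow>
     P \<in> Obj T \<and> (\<forall>i\<in>I. X i \<in> Obj T \<and> p i \<in> Hom T (X i) P) \<and>
     (\<forall>Y\<in>Obj T. \<forall>f. (\<forall>i\<in>I. f i \<in> Hom T (X i) Y) \<longrightarrow>
        (\<exists>!g. g \<in> Hom T P Y \<and> (\<forall>i\<in>I. g \<cdot>\<^bsub>T\<^esub> p i = f i)))"

text \<open>
  \<open>h\<close> is the coproduct of the arrows \<open>f i\<close>, from the coproduct \<open>(P, p)\<close> of
  their domains to the coproduct \<open>(Q, q)\<close> of their codomains.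
\<close>

definition is_coproduct_arr ::
  "('o, 'm, 'x) category_scheme \<Rightarrow> 'i set \<Rightarrow> ('i \<Rightarrow> 'm) \<Rightarrow>
     'o \<Rightarrow> ('i \<Rightarrow> 'm) \<Rightarrow> 'o \<Rightarrow> ('i \<Rightarrow> 'm) \<Rightarrow> 'm \<Rightarrow> bool" where
  "is_coproduct_arr T I f P p Q q h \<longleftrightarrow>
     (\<forall>i\<in>I. f i \<in> Arr T) \<and>
     is_coproduct T I (\<lambda>i. Dom T (f i)) P p \<and>
     is_coproduct T I (\<lambda>i. Cod T (f i)) Q q \<and>
     h \<in> Hom T P Q \<and> (\<forall>i\<in>I. h \<cdot>\<^bsub>T\<^esub> p i = q i \<cdot>\<^bsub>T\<^esub> f i)"

definition has_coproducts :: "('o, 'm, 'x) category_scheme \<Rightarrow> 'u rel \<Rightarrow> bool" where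
  "has_coproducts T \<kappa> \<longleftrightarrow>
     (\<forall>(I::'u set) X. |I| <o \<kappa> \<longrightarrow> (\<forall>i\<in>I. X i \<in> Obj T) \<longrightarrow> (\<exists>P p. is_coproduct T I X P p))"


section \<open>Additive categories\<close>

record ('o, 'm) preadditive_category = "('o, 'm) category" +
  Add :: "'m \<Rightarrow> 'm \<Rightarrow> 'm"
  ZeroArr :: "'o \<Rightarrow> 'o \<Rightarrow> 'm"

text \<open>The group operation is written multiplicatively, so \<open>inv\<close> is the additive inverse.\<close>

definition hom_group :: "('o, 'm, 'x) preadditive_category_scheme \<Rightarrow> 'o \<Rightarrow> 'o \<Rightarrow> 'm monoid" where
  "hom_group T X Y = \<lparr>carrier = Hom T X Y, mult = Add T, one = ZeroArr T X Y\<rparr>"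

locale additive_category = category T
  for T :: "('o, 'm, 'x) preadditive_category_scheme" (structure) +
  assumes hom_comm_group: "\<lbrakk>X \<in> Obj T; Y \<in> Obj T\<rbrakk> \<Longrightarrow> comm_group (hom_group T X Y)"
    and comp_add_left:
      "\<lbrakk>f \<in> Hom T X Y; g \<in> Hom T Y Z; g' \<in> Hom T Y Z\<rbrakk>
        \<Longrightarrow> Add T g g' \<cdot> f = Add T (g \<cdot> f) (g' \<cdot> f)"
    and comp_add_right:
      "\<lbrakk>f \<in> Hom T X Y; f' \<in> Hom T X Y; g \<in> Hom T Y Z\<rbrakk>
        \<Longrightarrow> g \<cdot> Add T f f' = Add T (g \<cdot> f) (g \<cdot> f')"
    and ex_zero_obj: "\<exists>Z. zero_obj T Z"
    and ex_binary_coproduct: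
      "\<lbrakk>X \<in> Obj T; Y \<in> Obj T\<rbrakk>
        \<Longrightarrow> \<exists>P p. is_coproduct T UNIV (\<lambda>b::bool. if b then X else Y) P p"

definition ideal :: "('o, 'm, 'x) preadditive_category_scheme \<Rightarrow> 'm set \<Rightarrow> bool" where
  "ideal T J \<longleftrightarrow> J \<subseteq> Arr T \<and>
     (\<forall>X\<in>Obj T. \<forall>Y\<in>Obj T. subgroup (J \<inter> Hom T X Y) (hom_group T X Y)) \<and>
     (\<forall>f\<in>J. \<forall>g\<in>Arr T. Dom T g = Cod T f \<longrightarrow> g \<cdot>\<^bsub>T\<^esub> f \<in> J) \<and>
     (\<forall>f\<in>J. \<forall>g\<in>Arr T. Cod T g = Dom T f \<longrightarrow> f \<cdot>\<^bsub>T\<^esub> g \<in> J)"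


section \<open>Triangulated categories\<close>

text \<open>
  \<open>(f, g, h) \<in> Dist T\<close> means that the triangle with consecutive arrows \<open>f\<close>, \<open>g\<close>,
  \<open>h\<close> is distinguished.
\<close>

record ('o, 'm) triangulated_category = "('o, 'm) preadditive_category" +
  SuspObj :: "'o \<Rightarrow> 'o"
  SuspArr :: "'m \<Rightarrow> 'm"
  Dist :: "('m \<times> 'm \<times> 'm) set"

definition triangle :: "('o, 'm, 'x) triangulated_category_scheme \<Rightarrow> 'm \<Rightarrow> 'm \<Rightarrow> 'm \<Rightarrow> bool" where
  "triangle T f g h \<longleftrightarrow>
     f \<in> Arr T \<and> g \<in> Arr T \<and> h \<in> Arr T \<and>
     Cod T f = Dom T g \<and> Cod T g = Dom T h \<and> Cod T h = SuspObj T (Dom T f)"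

text \<open>
  The suspension is an additive self-equivalence, i.e. fully faithful and essentially surjective;
  it need not be an automorphism.
\<close>

locale triangulated_category = additive_category T
  for T :: "('o, 'm, 'x) triangulated_category_scheme" (structure) +
  assumes susp_obj: "X \<in> Obj T \<Longrightarrow> SuspObj T X \<in> Obj T"
    and susp_ide: "X \<in> Obj T \<Longrightarrow> SuspArr T (Ide T X) = Ide T (SuspObj T X)"
    and susp_comp:
      "\<lbrakk>f \<in> Hom T X Y; g \<in> Hom T Y Z\<rbrakk> \<Longrightarrow> SuspArr T (g \<cdot> f) = SuspArr T g \<cdot> SuspArr T f"
    and susp_add:
      "\<lbrakk>f \<in> Hom T X Y; g \<in> Hom T X Y\<rbrakk>
        \<Longrightarrow> SuspArr T (Add T f g) = Add T (SuspArr T f) (SuspArr T g)"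
    and susp_fully_faithful:
      "\<lbrakk>X \<in> Obj T; Y \<in> Obj T\<rbrakk>
        \<Longrightarrow> bij_betw (SuspArr T) (Hom T X Y) (Hom T (SuspObj T X) (SuspObj T Y))"
    and susp_essentially_surj: "Y \<in> Obj T \<Longrightarrow> \<exists>X\<in>Obj T. iso_obj T (SuspObj T X) Y"
    and dist_triangle: "(f, g, h) \<in> Dist T \<Longrightarrow> triangle T f g h"
    and dist_iso:
      "\<lbrakk>(f, g, h) \<in> Dist T; triangle T f' g' h';
        a \<in> Hom T (Dom T f) (Dom T f'); b \<in> Hom T (Dom T g) (Dom T g');
        c \<in> Hom T (Dom T h) (Dom T h'); iso_arr T a; iso_arr T b; iso_arr T c;
        f' \<cdot> a = b \<cdot> f; g' \<cdot> b = c \<cdot> g; h' \<cdot> c = SuspArr T a \<cdot> h\<rbrakk>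
        \<Longrightarrow> (f', g', h') \<in> Dist T"
    and dist_ide:
      "\<lbrakk>X \<in> Obj T; zero_obj T Z\<rbrakk>
        \<Longrightarrow> (Ide T X, ZeroArr T X Z, ZeroArr T Z (SuspObj T X)) \<in> Dist T"
    and dist_embed: "f \<in> Arr T \<Longrightarrow> \<exists>g h. (f, g, h) \<in> Dist T"
    and dist_rotate:
      "triangle T f g h \<Longrightarrow>
        (f, g, h) \<in> Dist T \<longleftrightarrow>
        (g, h, inv\<^bsub>hom_group T (SuspObj T (Dom T f)) (SuspObj T (Cod T f))\<^esub> (SuspArr T f)) \<in> Dist T"
    and dist_morphism:
      "\<lbrakk>(f, g, h) \<in> Dist T; (f', g', h') \<in> Dist T;
        a \<in> Hom T (Dom T f) (Dom T f'); b \<in> Hom T (Dom T g) (Dom T g');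
        f' \<cdot> a = b \<cdot> f\<rbrakk>
        \<Longrightarrow> \<exists>c \<in> Hom T (Dom T h) (Dom T h'). g' \<cdot> b = c \<cdot> g \<and> h' \<cdot> c = SuspArr T a \<cdot> h"
    and dist_octahedral:
      "\<lbrakk>f \<in> Hom T X Y; g \<in> Hom T Y Z;
        (f, u, u') \<in> Dist T; (g, v, v') \<in> Dist T; (g \<cdot> f, w, w') \<in> Dist T\<rbrakk>
        \<Longrightarrow> \<exists>p \<in> Hom T (Cod T u) (Cod T w). \<exists>q \<in> Hom T (Cod T w) (Cod T v).
              (p, q, SuspArr T u \<cdot> v') \<in> Dist T \<and>
              p \<cdot> u = w \<cdot> g \<and> w' \<cdot> p = u' \<and>
              q \<cdot> w = v \<and> v' \<cdot> q = SuspArr T f \<cdot> w'"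


section \<open>Well generated triangulated categories\<close>

definition small_object ::
  "('o, 'm, 'x) category_scheme \<Rightarrow> 'u rel \<Rightarrow> 'u rel \<Rightarrow> 'o \<Rightarrow> bool" where
  "small_object T \<kappa> \<alpha> S \<longleftrightarrow> S \<in> Obj T \<and>
     (\<forall>(I::'u set) X P p. |I| <o \<kappa> \<longrightarrow> is_coproduct T I X P p \<longrightarrow>
       (\<forall>f \<in> Hom T S P.
          \<exists>I' P' p'. I' \<subseteq> I \<and> |I'| <o \<alpha> \<and> is_coproduct T I' X P' p' \<and>
            (\<exists>c \<in> Hom T P' P. \<exists>g \<in> Hom T S P'. (\<forall>i\<in>I'. c \<cdot>\<^bsub>T\<^esub> p' i = p i) \<and> f = c \<cdot>\<^bsub>T\<^esub> g)))"

definition generates :: "('o, 'm, 'x) preadditive_category_scheme \<Rightarrow> 'o set \<Rightarrow> bool" where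
  "generates T \<S> \<longleftrightarrow> \<S> \<subseteq> Obj T \<and>
     (\<forall>X\<in>Obj T. zero_obj T X \<longleftrightarrow> (\<forall>S\<in>\<S>. Hom T S X = {ZeroArr T S X}))"

definition hom_surj :: "('o, 'm, 'x) category_scheme \<Rightarrow> 'o \<Rightarrow> 'm \<Rightarrow> bool" where
  "hom_surj T S f \<longleftrightarrow> (\<lambda>g. f \<cdot>\<^bsub>T\<^esub> g) ` Hom T S (Dom T f) = Hom T S (Cod T f)"

definition perfect :: "('o, 'm, 'x) category_scheme \<Rightarrow> 'u rel \<Rightarrow> 'o set \<Rightarrow> bool" where
  "perfect T \<kappa> \<S> \<longleftrightarrow> \<S> \<subseteq> Obj T \<and>
     (\<forall>(I::'u set) f P p Q q h. |I| <o \<kappa> \<longrightarrow>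
        (\<forall>i\<in>I. f i \<in> Arr T \<and> (\<forall>S\<in>\<S>. hom_surj T S (f i))) \<longrightarrow>
        is_coproduct_arr T I f P p Q q h \<longrightarrow> (\<forall>S\<in>\<S>. hom_surj T S h))"

definition compactly_generated ::
  "('o, 'm, 'x) preadditive_category_scheme \<Rightarrow> 'u rel \<Rightarrow> 'u rel \<Rightarrow> bool" where
  "compactly_generated T \<kappa> \<alpha> \<longleftrightarrow>
     (\<exists>\<S>. |\<S>| <o \<kappa> \<and> (\<forall>S\<in>\<S>. small_object T \<kappa> \<alpha> S) \<and> generates T \<S> \<and> perfect T \<kappa> \<S>)"

definition well_generated :: "('o, 'm, 'x) preadditive_category_scheme \<Rightarrow> 'u rel \<Rightarrow> bool" where
  "well_generated T \<kappa> \<longleftrightarrow>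
     (\<exists>\<alpha>. small_regular_cardinal \<kappa> \<alpha> \<and> compactly_generated T \<kappa> \<alpha>)"

text \<open>The condition on a class of objects of which \<open>compact_objects\<close> is the maximal instance.\<close>

definition compact_class ::
  "('o, 'm, 'x) category_scheme \<Rightarrow> 'u rel \<Rightarrow> 'u rel \<Rightarrow> 'o set \<Rightarrow> bool" where
  "compact_class T \<kappa> \<alpha> \<S> \<longleftrightarrow> (\<forall>S\<in>\<S>. small_object T \<kappa> \<alpha> S) \<and>
     (\<forall>(I::'u set) X P p. |I| <o \<kappa> \<longrightarrow> is_coproduct T I X P p \<longrightarrow>
       (\<forall>S\<in>\<S>. \<forall>k \<in> Hom T S P.
          \<exists>f Q q h. (\<forall>i\<in>I. \<exists>R\<in>\<S>. f i \<in> Hom T R (X i)) \<and>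
            is_coproduct_arr T I f Q q P p h \<and> (\<exists>g \<in> Hom T S Q. k = h \<cdot>\<^bsub>T\<^esub> g)))"

definition compact_objects ::
  "('o, 'm, 'x) category_scheme \<Rightarrow> 'u rel \<Rightarrow> 'u rel \<Rightarrow> 'o set" where
  "compact_objects T \<kappa> \<alpha> =
     (THE \<S>. compact_class T \<kappa> \<alpha> \<S> \<and>
        (\<forall>\<S>'. compact_class T \<kappa> \<alpha> \<S>' \<longrightarrow> \<S> \<subseteq> \<S>' \<longrightarrow> \<S>' = \<S>))"

text \<open>The unique maximal class exists and is the largest one.\<close>

lemma compact_class_Union:
  fixes T :: "('o, 'm, 'x) category_scheme" and \<kappa> \<alpha> :: "'u rel"
  assumes "\<And>\<S>. \<S> \<in> \<A> \<Longrightarrow> compact_class T \<kappa> \<alpha> \<S>"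
  shows "compact_class T \<kappa> \<alpha> (\<Union>\<A>)"
  unfolding compact_class_def
proof (intro conjI allI impI ballI)
  fix S assume "S \<in> \<Union>\<A>"
  then show "small_object T \<kappa> \<alpha> S"
    using assms unfolding compact_class_def by blast
next
  fix I :: "'u set" and X P p S k
  assume I: "|I| <o \<kappa>" and P: "is_coproduct T I X P p"
    and S: "S \<in> \<Union>\<A>" and k: "k \<in> Hom T S P"
  from S obtain \<S> where \<S>: "\<S> \<in> \<A>" "S \<in> \<S>" by blast
  have "\<forall>(I::'u set) X P p. |I| <o \<kappa> \<longrightarrow> is_coproduct T I X P p \<longrightarrow>
       (\<forall>S\<in>\<S>. \<forall>k \<in> Hom T S P.
          \<exists>f Q q h. (\<forall>i\<in>I. \<exists>R\<in>\<S>. f i \<in> Hom T R (X i)) \<and>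
            is_coproduct_arr T I f Q q P p h \<and> (\<exists>g \<in> Hom T S Q. k = h \<cdot>\<^bsub>T\<^esub> g))"
    using assms[OF \<S>(1)] unfolding compact_class_def by (rule conjunct2)
  from this[rule_format, OF I P \<S>(2) k]
  obtain f Q q h where *: "\<forall>i\<in>I. \<exists>R\<in>\<S>. f i \<in> Hom T R (X i)"
    "is_coproduct_arr T I f Q q P p h" "\<exists>g \<in> Hom T S Q. k = h \<cdot>\<^bsub>T\<^esub> g"
    by blast
  have "\<forall>i\<in>I. \<exists>R\<in>\<Union>\<A>. f i \<in> Hom T R (X i)"
    using *(1) \<S>(1) by blast
  then show "\<exists>f Q q h. (\<forall>i\<in>I. \<exists>R\<in>\<Union>\<A>. f i \<in> Hom T R (X i)) \<and>
      is_coproduct_arr T I f Q q P p h \<and> (\<exists>g \<in> Hom T S Q. k = h \<cdot>\<^bsub>T\<^esub> g)"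
    using *(2,3) by blast
qed

lemma compact_objects_eq_Union:
  "compact_objects T \<kappa> \<alpha> = \<Union>{\<S>. compact_class T \<kappa> \<alpha> \<S>}" (is "_ = ?U")
proof -
  have U: "compact_class T \<kappa> \<alpha> ?U"
    by (rule compact_class_Union) simp
  show ?thesis
    unfolding compact_objects_def
  proof (rule the_equality)
    show "compact_class T \<kappa> \<alpha> ?U \<and>
        (\<forall>\<S>'. compact_class T \<kappa> \<alpha> \<S>' \<longrightarrow> ?U \<subseteq> \<S>' \<longrightarrow> \<S>' = ?U)"
      using U by blast
  next
    fix \<S>
    assume *: "compact_class T \<kappa> \<alpha> \<S> \<and>
        (\<forall>\<S>'. compact_class T \<kappa> \<alpha> \<S>' \<longrightarrow> \<S> \<subseteq> \<S>' \<longrightarrow> \<S>' = \<S>)"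
    then have "\<S> \<subseteq> ?U" by blast
    then show "\<S> = ?U" using * U by blast
  qed
qed

lemma compact_class_compact_objects: "compact_class T \<kappa> \<alpha> (compact_objects T \<kappa> \<alpha>)"
  unfolding compact_objects_eq_Union by (rule compact_class_Union) simp


section \<open>Full subcategories\<close>

text \<open>
  A full subcategory is given by its class of objects, which need not be closed under
  isomorphisms; accordingly the closure conditions are up to isomorphism.  A full subcategory of a
  locally small category is essentially small if it has a small skeleton.
\<close>

definition essentially_small :: "('o, 'm, 'x) category_scheme \<Rightarrow> 'u rel \<Rightarrow> 'o set \<Rightarrow> bool" where
  "essentially_small T \<kappa> \<C> \<longleftrightarrow>
     (\<exists>\<D>\<subseteq>\<C>. |\<D>| <o \<kappa> \<and> (\<forall>C\<in>\<C>. \<exists>D\<in>\<D>. iso_obj T C D))"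

definition closed_under_susp :: "('o, 'm, 'x) triangulated_category_scheme \<Rightarrow> 'o set \<Rightarrow> bool" where
  "closed_under_susp T \<C> \<longleftrightarrow> (\<forall>C\<in>\<C>. \<exists>C'\<in>\<C>. iso_obj T C' (SuspObj T C))"

definition closed_under_desusp :: "('o, 'm, 'x) triangulated_category_scheme \<Rightarrow> 'o set \<Rightarrow> bool" where
  "closed_under_desusp T \<C> \<longleftrightarrow> (\<forall>C\<in>\<C>. \<exists>C'\<in>\<C>. iso_obj T (SuspObj T C') C)"

definition closed_under_coproducts ::
  "('o, 'm, 'x) category_scheme \<Rightarrow> 'u rel \<Rightarrow> 'o set \<Rightarrow> bool" where
  "closed_under_coproducts T \<alpha> \<C> \<longleftrightarrow>
     (\<forall>(I::'u set) X. |I| <o \<alpha> \<longrightarrow> (\<forall>i\<in>I. X i \<in> \<C>) \<longrightarrow>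
        (\<exists>P\<in>\<C>. \<exists>p. is_coproduct T I X P p))"


section \<open>Phantom maps\<close>

definition phantom :: "('o, 'm, 'x) preadditive_category_scheme \<Rightarrow> 'o set \<Rightarrow> 'm \<Rightarrow> bool" where
  "phantom T \<C> f \<longleftrightarrow> f \<in> Arr T \<and>
     (\<forall>C\<in>\<C>. \<forall>g \<in> Hom T C (Dom T f). f \<cdot>\<^bsub>T\<^esub> g = ZeroArr T C (Cod T f))"

inductive n_phantom ::
  "('o, 'm, 'x) preadditive_category_scheme \<Rightarrow> 'o set \<Rightarrow> nat \<Rightarrow> 'm \<Rightarrow> bool"
  for T \<C> where
  one: "phantom T \<C> f \<Longrightarrow> n_phantom T \<C> 1 f"
| comp: "\<lbrakk>phantom T \<C> f; n_phantom T \<C> n g; Cod T g = Dom T f\<rbrakk>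
    \<Longrightarrow> n_phantom T \<C> (Suc n) (f \<cdot>\<^bsub>T\<^esub> g)"

definition infinity_phantoms :: "('o, 'm, 'x) preadditive_category_scheme \<Rightarrow> 'o set \<Rightarrow> 'm set" where
  "infinity_phantoms T \<C> = {f. \<forall>n>0. n_phantom T \<C> n f}"

end

theory Submission
  imports Defs
begin

text \<open>
  Every object \<open>X\<close> has a map \<open>p : F \<rightarrow> X\<close> from a small coproduct of objects of
  \<open>\<C>\<close> such that each map from an object of \<open>\<C>\<close> to \<open>X\<close> factors through \<open>p\<close>.  Its
  cone \<open>x : X \<rightarrow> X'\<close> is a phantom map through which all phantom maps out of \<open>X\<close> factor.
  Iterating this construction gives the phantom tower \<open>X = X\<^sub>0 \<rightarrow> X\<^sub>1 \<rightarrow> \<dots>\<close> with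
  composites \<open>j\<^sub>n : X \<rightarrow> X\<^sub>n\<close>.  Three facts about the tower prove the theorem.

  (a) The \<open>n\<close>-phantom maps out of \<open>X\<close> are exactly the maps that factor through
  \<open>j\<^sub>n\<close> (lemma \<open>n_phantom_iff\<close>).  In particular their sums are \<open>n\<close>-phantom maps, which
  is the part of the ideal property that the definition does not give directly.

  (b) If \<open>a : X\<^sub>n \<rightarrow> Y\<close> satisfies \<open>a j\<^sub>n = 0\<close> and \<open>k\<close> is an \<open>n\<close>-phantom
  map out of \<open>Y\<close>, then \<open>k a = 0\<close> (lemma \<open>n_phantom_kills_maps_vanishing_on_source\<close>).  The
  reason is that \<open>a\<close> factors through the suspended fibre of \<open>j\<^sub>n\<close>, an \<open>n\<close>-fold
  extension of suspended coproducts of objects of \<open>\<C>\<close>, each of which is killed by phantom maps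
  because \<open>\<C>\<close> is closed under suspension.

  (c) The homotopy colimit of the tower is zero: a family of maps \<open>m\<^sub>n : X\<^sub>n \<rightarrow> Z\<close>
  compatible with the tower vanishes (lemma \<open>compatible_maps_from_tower_zero\<close>).  Since \<open>\<C>\<close> is
  perfect, the shift \<open>s\<close> on \<open>\<Coprod>\<^sub>n X\<^sub>n\<close>, whose components are phantom maps, is a
  phantom map.  So \<open>1 - s\<close> induces the identity on maps from \<open>\<C>\<close>, and its cone is zero because
  \<open>\<C>\<close> generates and is closed under desuspension.

  Now let \<open>h : X \<rightarrow> Y\<close> and \<open>k : Y \<rightarrow> Z\<close> be \<open>n\<close>-phantom maps for all \<open>n\<close>.  By
  (a), \<open>h = h\<^sub>n j\<^sub>n\<close> for every \<open>n\<close>.  The difference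
  \<open>h\<^sub>n - h\<^bsub>n+1\<^esub> x\<^sub>n\<close>,
  where \<open>x\<^sub>n : X\<^sub>n \<rightarrow> X\<^bsub>n+1\<^esub>\<close>, vanishes on \<open>j\<^sub>n\<close>, so \<open>k\<close> kills it by (b).  Hence
  the maps \<open>k h\<^sub>n\<close> are compatible with the tower, and \<open>k h = k h\<^sub>0 = 0\<close> by (c).
\<close>

section \<open>Additive categories\<close>

lemma HomI: "f \<in> Arr T \<Longrightarrow> Dom T f = X \<Longrightarrow> Cod T f = Y \<Longrightarrow> f \<in> Hom T X Y"
  by (simp add: Hom_def)

lemma HomD: "f \<in> Hom T X Y \<Longrightarrow> f \<in> Arr T" "f \<in> Hom T X Y \<Longrightarrow> Dom T f = X"
  "f \<in> Hom T X Y \<Longrightarrow> Cod T f = Y"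
  by (simp_all add: Hom_def)

lemma hom_group_simps [simp]:
  "carrier (hom_group T X Y) = Hom T X Y"
  "mult (hom_group T X Y) = Add T"
  "one (hom_group T X Y) = ZeroArr T X Y"
  by (simp_all add: hom_group_def)

lemma (in category) Hom_obj: "f \<in> Hom T X Y \<Longrightarrow> X \<in> Obj T" "f \<in> Hom T X Y \<Longrightarrow> Y \<in> Obj T"
  using dom_obj cod_obj by (auto simp: Hom_def)

lemma (in category) iso_objE:
  assumes "iso_obj T X Y"
  obtains a b where "a \<in> Hom T X Y" "b \<in> Hom T Y X" "b \<cdot> a = Ide T X" "a \<cdot> b = Ide T Y"
  using assms unfolding iso_obj_def iso_arr_def Hom_def by auto

lemma is_coproduct_cong:
  assumes "\<And>i. i \<in> I \<Longrightarrow> X i = Y i"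
  shows "is_coproduct T I X P p = is_coproduct T I Y P p"
  using assms by (simp add: is_coproduct_def)

lemma (in category) coproduct_hom_eqI:
  assumes "is_coproduct T I X P p" "f \<in> Hom T P Y" "g \<in> Hom T P Y"
    and "\<And>i. i \<in> I \<Longrightarrow> f \<cdot> p i = g \<cdot> p i"
  shows "f = g"
proof -
  have "\<forall>i\<in>I. g \<cdot> p i \<in> Hom T (X i) Y"
    using assms(1,3) comp_hom unfolding is_coproduct_def by blast
  then have "\<exists>!h. h \<in> Hom T P Y \<and> (\<forall>i\<in>I. h \<cdot> p i = g \<cdot> p i)"
    using assms(1) Hom_obj(2)[OF assms(3)] unfolding is_coproduct_def by (auto dest!: bspec)
  then show ?thesis using assms(2-4) by blast
qed

lemma (in category) coproduct_map:
  assumes "is_coproduct T I X P p" "Y \<in> Obj T" "\<And>i. i \<in> I \<Longrightarrow> f i \<in> Hom T (X i) Y"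
  obtains g where "g \<in> Hom T P Y" "\<And>i. i \<in> I \<Longrightarrow> g \<cdot> p i = f i"
  using assms unfolding is_coproduct_def by blast

context additive_category
begin

lemma zero_hom: "X \<in> Obj T \<Longrightarrow> Y \<in> Obj T \<Longrightarrow> ZeroArr T X Y \<in> Hom T X Y"
  using monoid.one_closed[OF group.is_monoid[OF comm_group.axioms(2)[OF hom_comm_group]], of X Y]
  by simp

lemma group_hom_group: "f \<in> Hom T X Y \<Longrightarrow> group (hom_group T X Y)"
  by (rule comm_group.axioms(2)[OF hom_comm_group]) (erule Hom_obj)+

lemma add_hom:
  assumes "f \<in> Hom T X Y" "g \<in> Hom T X Y"
  shows "Add T f g \<in> Hom T X Y"
  using monoid.m_closed[OF group.is_monoid[OF group_hom_group[OF assms(1)]], of f g] assms by simp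

lemma neg_hom: "f \<in> Hom T X Y \<Longrightarrow> inv\<^bsub>hom_group T X Y\<^esub> f \<in> Hom T X Y"
  using group.inv_closed[OF group_hom_group, of f X Y f] by simp

lemma add_zero_right: "f \<in> Hom T X Y \<Longrightarrow> Add T f (ZeroArr T X Y) = f"
  using monoid.r_one[OF group.is_monoid[OF group_hom_group], of f X Y f] by simp

lemma add_neg: "f \<in> Hom T X Y \<Longrightarrow> Add T f (inv\<^bsub>hom_group T X Y\<^esub> f) = ZeroArr T X Y"
  using group.r_inv[OF group_hom_group, of f X Y f] by simp

lemma neg_zero:
  "X \<in> Obj T \<Longrightarrow> Y \<in> Obj T \<Longrightarrow> inv\<^bsub>hom_group T X Y\<^esub> (ZeroArr T X Y) = ZeroArr T X Y"
  using monoid.inv_one[OF group.is_monoid[OF comm_group.axioms(2)[OF hom_comm_group]], of X Y]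
  by simp

lemma neg_neg: "f \<in> Hom T X Y \<Longrightarrow> inv\<^bsub>hom_group T X Y\<^esub> (inv\<^bsub>hom_group T X Y\<^esub> f) = f"
  using group.inv_inv[OF group_hom_group, of f X Y f] by simp

lemma neg_unique:
  assumes "f \<in> Hom T X Y" "g \<in> Hom T X Y" "Add T f g = ZeroArr T X Y"
  shows "inv\<^bsub>hom_group T X Y\<^esub> f = g"
proof -
  interpret comm_group "hom_group T X Y" using hom_comm_group Hom_obj[OF assms(1)] by blast
  show ?thesis using inv_equality[of g f] assms m_comm[of f g] by simp
qed

lemma add_idem_zero:
  assumes "f \<in> Hom T X Y" "Add T f f = f"
  shows "f = ZeroArr T X Y"
proof -
  interpret group "hom_group T X Y" using group_hom_group[OF assms(1)] .
  show ?thesis using assms l_cancel_one[of f f] by simp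
qed

lemma comp_zero_right:
  assumes "g \<in> Hom T Y Z" "X \<in> Obj T"
  shows "g \<cdot> ZeroArr T X Y = ZeroArr T X Z"
proof (rule add_idem_zero)
  have 0: "ZeroArr T X Y \<in> Hom T X Y" using zero_hom Hom_obj(1)[OF assms(1)] assms(2) by blast
  show "g \<cdot> ZeroArr T X Y \<in> Hom T X Z" using comp_hom 0 assms by blast
  show "Add T (g \<cdot> ZeroArr T X Y) (g \<cdot> ZeroArr T X Y) = g \<cdot> ZeroArr T X Y"
    by (simp only: comp_add_right[OF 0 0 assms(1), symmetric] add_zero_right[OF 0])
qed

lemma comp_zero_left:
  assumes "f \<in> Hom T X Y" "Z \<in> Obj T"
  shows "ZeroArr T Y Z \<cdot> f = ZeroArr T X Z"
proof (rule add_idem_zero)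
  have 0: "ZeroArr T Y Z \<in> Hom T Y Z" using zero_hom Hom_obj(2)[OF assms(1)] assms(2) by blast
  show "ZeroArr T Y Z \<cdot> f \<in> Hom T X Z" using comp_hom 0 assms by blast
  show "Add T (ZeroArr T Y Z \<cdot> f) (ZeroArr T Y Z \<cdot> f) = ZeroArr T Y Z \<cdot> f"
    by (simp only: comp_add_left[OF assms(1) 0 0, symmetric] add_zero_right[OF 0])
qed

lemma comp_neg_left:
  assumes "f \<in> Hom T X Y" "g \<in> Hom T Y Z"
  shows "inv\<^bsub>hom_group T Y Z\<^esub> g \<cdot> f = inv\<^bsub>hom_group T X Z\<^esub> (g \<cdot> f)"
proof (rule neg_unique[symmetric, OF comp_hom[OF assms] comp_hom[OF assms(1) neg_hom[OF assms(2)]]])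
  show "Add T (g \<cdot> f) (inv\<^bsub>hom_group T Y Z\<^esub> g \<cdot> f) = ZeroArr T X Z"
    unfolding comp_add_left[OF assms neg_hom[OF assms(2)], symmetric] add_neg[OF assms(2)]
    by (rule comp_zero_left[OF assms(1) Hom_obj(2)[OF assms(2)]])
qed

lemma comp_neg_right:
  assumes "f \<in> Hom T X Y" "g \<in> Hom T Y Z"
  shows "g \<cdot> inv\<^bsub>hom_group T X Y\<^esub> f = inv\<^bsub>hom_group T X Z\<^esub> (g \<cdot> f)"
proof (rule neg_unique[symmetric, OF comp_hom[OF assms] comp_hom[OF neg_hom[OF assms(1)] assms(2)]])
  show "Add T (g \<cdot> f) (g \<cdot> inv\<^bsub>hom_group T X Y\<^esub> f) = ZeroArr T X Z"
    unfolding comp_add_right[OF assms(1) neg_hom[OF assms(1)] assms(2), symmetric] add_neg[OF assms(1)]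
    by (rule comp_zero_right[OF assms(2) Hom_obj(1)[OF assms(1)]])
qed

lemma neg_eq_iff:
  assumes "f \<in> Hom T X Y" "g \<in> Hom T X Y"
  shows "inv\<^bsub>hom_group T X Y\<^esub> f = inv\<^bsub>hom_group T X Y\<^esub> g \<longleftrightarrow> f = g"
  by (metis neg_neg[OF assms(1)] neg_neg[OF assms(2)])

lemma eq_if_diff_zero:
  assumes "f \<in> Hom T X Y" "g \<in> Hom T X Y"
    and "Add T f (inv\<^bsub>hom_group T X Y\<^esub> g) = ZeroArr T X Y"
  shows "f = g"
  using neg_unique[OF assms(1) neg_hom[OF assms(2)] assms(3)]
    neg_eq_iff[OF assms(1,2)] by (rule iffD1[rotated])

lemma hom_zero_obj_eq:
  assumes "zero_obj T Z"
  shows "f \<in> Hom T X Z \<Longrightarrow> g \<in> Hom T X Z \<Longrightarrow> f = g"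
    and "f \<in> Hom T Z X \<Longrightarrow> g \<in> Hom T Z X \<Longrightarrow> f = g"
proof -
  have 1: "\<exists>!h. h \<in> Hom T Z X" "\<exists>!h. h \<in> Hom T X Z" if "X \<in> Obj T"
    using assms that unfolding zero_obj_def by simp_all
  show "f = g" if "f \<in> Hom T X Z" "g \<in> Hom T X Z"
    using ex1E[OF 1(2)[OF Hom_obj(1)[OF that(1)]]] that by (metis (full_types))
  show "f = g" if "f \<in> Hom T Z X" "g \<in> Hom T Z X"
    using ex1E[OF 1(1)[OF Hom_obj(2)[OF that(1)]]] that by (metis (full_types))
qed

lemma zero_obj_if_ide_zero:
  assumes "Z \<in> Obj T" "Ide T Z = ZeroArr T Z Z"
  shows "zero_obj T Z"
proof -
  have 1: "f = ZeroArr T Z X" if "f \<in> Hom T Z X" for f X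
    using that comp_ide_right[OF that] comp_zero_right[OF that assms(1)] assms(2) by simp
  have 2: "f = ZeroArr T X Z" if "f \<in> Hom T X Z" for f X
    using that comp_ide_left[OF that] comp_zero_left[OF that assms(1)] assms(2) by simp
  have "\<exists>!f. f \<in> Hom T Z X" "\<exists>!f. f \<in> Hom T X Z" if X: "X \<in> Obj T" for X
    by (rule ex1I, rule zero_hom[OF assms(1) X], erule 1)
       (rule ex1I, rule zero_hom[OF X assms(1)], erule 2)
  then show ?thesis unfolding zero_obj_def using assms(1) by blast
qed

end

section \<open>Triangulated categories\<close>

context triangulated_category
begin

lemma susp_hom: "f \<in> Hom T X Y \<Longrightarrow> SuspArr T f \<in> Hom T (SuspObj T X) (SuspObj T Y)"
  using bij_betwE[OF susp_fully_faithful[OF Hom_obj]] by blast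

lemma susp_full:
  assumes "X \<in> Obj T" "Y \<in> Obj T" "g \<in> Hom T (SuspObj T X) (SuspObj T Y)"
  obtains f where "f \<in> Hom T X Y" "SuspArr T f = g"
proof -
  have "g \<in> SuspArr T ` Hom T X Y"
    using bij_betw_imp_surj_on[OF susp_fully_faithful[OF assms(1,2)]] assms(3) by simp
  then show thesis by (rule imageE) (rule that, simp_all)
qed

lemma susp_faithful:
  "f \<in> Hom T X Y \<Longrightarrow> g \<in> Hom T X Y \<Longrightarrow> SuspArr T f = SuspArr T g \<Longrightarrow> f = g"
  using inj_onD[OF bij_betw_imp_inj_on[OF susp_fully_faithful], of X Y f g] Hom_obj[of f X Y]
  by simp

lemma susp_zero:
  assumes "X \<in> Obj T" "Y \<in> Obj T"
  shows "SuspArr T (ZeroArr T X Y) = ZeroArr T (SuspObj T X) (SuspObj T Y)"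
proof (rule add_idem_zero)
  have 0: "ZeroArr T X Y \<in> Hom T X Y" using zero_hom assms by blast
  show "SuspArr T (ZeroArr T X Y) \<in> Hom T (SuspObj T X) (SuspObj T Y)" using susp_hom 0 .
  show "Add T (SuspArr T (ZeroArr T X Y)) (SuspArr T (ZeroArr T X Y)) = SuspArr T (ZeroArr T X Y)"
    by (simp only: susp_add[OF 0 0, symmetric] add_zero_right[OF 0])
qed

lemma zero_obj_susp:
  assumes "zero_obj T Z"
  shows "zero_obj T (SuspObj T Z)"
proof (rule zero_obj_if_ide_zero)
  have Z: "Z \<in> Obj T" using assms by (simp add: zero_obj_def)
  have "Ide T Z = ZeroArr T Z Z" by (rule hom_zero_obj_eq(1)[OF assms ide_hom[OF Z] zero_hom[OF Z Z]])
  then show "Ide T (SuspObj T Z) = ZeroArr T (SuspObj T Z) (SuspObj T Z)"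
    using susp_ide[OF Z] susp_zero[OF Z Z] by simp
  show "SuspObj T Z \<in> Obj T" using Z susp_obj by blast
qed

text \<open>
  Suspension is an equivalence, so it preserves coproducts; all that is used of this is that the
  suspended coproduct arrows are jointly epimorphic.
\<close>

lemma coproduct_susp_epi:
  assumes P: "is_coproduct T I X P p" and b: "b \<in> Hom T (SuspObj T P) Y"
    and 0: "\<And>i. i \<in> I \<Longrightarrow> b \<cdot> SuspArr T (p i) = ZeroArr T (SuspObj T (X i)) Y"
  shows "b = ZeroArr T (SuspObj T P) Y"
proof -
  have Y: "Y \<in> Obj T" using b Hom_obj by blast
  have PO: "P \<in> Obj T" and p: "\<And>i. i \<in> I \<Longrightarrow> p i \<in> Hom T (X i) P"
    using P by (auto simp: is_coproduct_def)
  obtain Y' where Y': "Y' \<in> Obj T" "iso_obj T (SuspObj T Y') Y"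
    using susp_essentially_surj[OF Y] by blast
  obtain u v where u: "u \<in> Hom T (SuspObj T Y') Y" and v: "v \<in> Hom T Y (SuspObj T Y')"
    and uv: "u \<cdot> v = Ide T Y"
    by (rule iso_objE[OF Y'(2)])
  obtain c where c: "c \<in> Hom T P Y'" "SuspArr T c = v \<cdot> b"
    using susp_full[OF PO Y'(1) comp_hom[OF b v]] .
  have c0: "c = ZeroArr T P Y'"
  proof (rule coproduct_hom_eqI[OF P c(1)])
    show "ZeroArr T P Y' \<in> Hom T P Y'" using zero_hom PO Y' by blast
    fix i assume i: "i \<in> I"
    have Xi: "X i \<in> Obj T" using Hom_obj p[OF i] by blast
    have "SuspArr T (c \<cdot> p i) = (v \<cdot> b) \<cdot> SuspArr T (p i)"
      by (simp only: susp_comp[OF p[OF i] c(1)] c(2))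
    also have "\<dots> = v \<cdot> (b \<cdot> SuspArr T (p i))"
      using comp_assoc[OF susp_hom[OF p[OF i]] b v] .
    also have "\<dots> = SuspArr T (ZeroArr T (X i) Y')"
      by (simp only: 0[OF i] comp_zero_right[OF v susp_obj[OF Xi]] susp_zero[OF Xi Y'(1)])
    finally have "c \<cdot> p i = ZeroArr T (X i) Y'"
      using susp_faithful[OF comp_hom[OF p[OF i] c(1)] zero_hom[OF Xi Y'(1)]] by blast
    then show "c \<cdot> p i = ZeroArr T P Y' \<cdot> p i"
      by (simp only: comp_zero_left[OF p[OF i] Y'(1)])
  qed
  have "b = u \<cdot> (v \<cdot> b)" by (simp only: comp_assoc[OF b v u, symmetric] uv comp_ide_left[OF b])
  also have "\<dots> = ZeroArr T (SuspObj T P) Y"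
    by (simp only: c(2)[symmetric] c0 susp_zero[OF PO Y'(1)] comp_zero_right[OF u susp_obj[OF PO]])
  finally show ?thesis .
qed

lemma distE:
  assumes "(f, g, h) \<in> Dist T"
  obtains X Y Z where "f \<in> Hom T X Y" "g \<in> Hom T Y Z" "h \<in> Hom T Z (SuspObj T X)"
  using dist_triangle[OF assms] unfolding triangle_def Hom_def by auto

lemma dist_rotate_left:
  assumes "(f, g, h) \<in> Dist T" "f \<in> Hom T X Y"
  shows "(g, h, inv\<^bsub>hom_group T (SuspObj T X) (SuspObj T Y)\<^esub> (SuspArr T f)) \<in> Dist T"
  using dist_rotate[OF dist_triangle[OF assms(1)]] assms by (simp add: Hom_def)

text \<open>
  The square with sides \<open>1\<close> and \<open>f\<close> extends to a morphism from the trivial triangle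
  on \<open>X\<close>, so that \<open>g f\<close> factors through a zero object.
\<close>

lemma dist_comp_zero:
  assumes d: "(f, g, h) \<in> Dist T" and f: "f \<in> Hom T X Y" and g: "g \<in> Hom T Y Z"
  shows "g \<cdot> f = ZeroArr T X Z"
proof -
  have h: "Dom T h = Z" using dist_triangle[OF d] g by (simp add: triangle_def Hom_def)
  obtain N where N: "zero_obj T N" using ex_zero_obj by blast
  have X: "X \<in> Obj T" and Z: "Z \<in> Obj T" and N': "N \<in> Obj T"
    using Hom_obj f g N by (auto simp: zero_obj_def)
  have z: "ZeroArr T X N \<in> Hom T X N" "ZeroArr T N (SuspObj T X) \<in> Hom T N (SuspObj T X)"
    using zero_hom X N' susp_obj by auto
  have "\<exists>c \<in> Hom T (Dom T (ZeroArr T N (SuspObj T X))) (Dom T h).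
      g \<cdot> f = c \<cdot> ZeroArr T X N \<and> h \<cdot> c = SuspArr T (Ide T X) \<cdot> ZeroArr T N (SuspObj T X)"
    by (rule dist_morphism[OF dist_ide[OF X N] d])
       (use HomD(2)[OF ide_hom[OF X]] HomD(2)[OF z(1)] HomD(2)[OF f] HomD(2)[OF g] ide_hom X f in auto)
  then obtain c where "c \<in> Hom T N Z" "g \<cdot> f = c \<cdot> ZeroArr T X N"
    using h HomD(2)[OF z(2)] by auto
  then show ?thesis using comp_zero_right X by simp
qed

text \<open>
  The arrow \<open>a\<close> and the zero arrow on \<open>X\<close> extend to a morphism to the trivial triangle
  \<open>0 \<rightarrow> W = W \<rightarrow> 0\<close>, whose third component is the factorization.
\<close>

lemma dist_weak_cokernel:
  assumes d: "(f, g, h) \<in> Dist T" and f: "f \<in> Hom T X Y" and g: "g \<in> Hom T Y Z"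
    and a: "a \<in> Hom T Y W" and 0: "a \<cdot> f = ZeroArr T X W"
  obtains b where "b \<in> Hom T Z W" "a = b \<cdot> g"
proof -
  have h: "Dom T h = Z" using dist_triangle[OF d] g by (simp add: triangle_def Hom_def)
  obtain N where N: "zero_obj T N" using ex_zero_obj by blast
  have X: "X \<in> Obj T" and W: "W \<in> Obj T" and N': "N \<in> Obj T"
    using Hom_obj f a N by (auto simp: zero_obj_def)
  let ?i = "ZeroArr T N W" and ?t = "ZeroArr T W (SuspObj T N)"
  have i: "?i \<in> Hom T N W" and t: "?t \<in> Hom T W (SuspObj T N)" and W1: "Ide T W \<in> Hom T W W"
    and z: "ZeroArr T X N \<in> Hom T X N"
    using zero_hom W N' X susp_obj ide_hom by auto
  have tri: "triangle T ?i (Ide T W) ?t"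
    using i t W1 by (simp add: triangle_def Hom_def)
  have "(Ide T W, ?t, ZeroArr T (SuspObj T N) (SuspObj T W)) \<in> Dist T"
    using dist_ide[OF W zero_obj_susp[OF N]] .
  moreover have "inv\<^bsub>hom_group T (SuspObj T (Dom T ?i)) (SuspObj T (Cod T ?i))\<^esub> (SuspArr T ?i)
      = ZeroArr T (SuspObj T N) (SuspObj T W)"
    using HomD[OF i] susp_zero[OF N' W] neg_zero susp_obj N' W by simp
  ultimately have d': "(?i, Ide T W, ?t) \<in> Dist T"
    using dist_rotate[OF tri] by simp
  have "\<exists>c \<in> Hom T (Dom T h) (Dom T ?t).
      Ide T W \<cdot> a = c \<cdot> g \<and> ?t \<cdot> c = SuspArr T (ZeroArr T X N) \<cdot> h"
  proof (rule dist_morphism[OF d d'])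
    show "ZeroArr T X N \<in> Hom T (Dom T f) (Dom T ?i)" using z HomD(2)[OF f] HomD(2)[OF i] by simp
    show "a \<in> Hom T (Dom T g) (Dom T (Ide T W))" using a HomD(2)[OF g] HomD(2)[OF W1] by simp
    show "?i \<cdot> ZeroArr T X N = a \<cdot> f" using comp_zero_right[OF i X] 0 by simp
  qed
  then show ?thesis using that h HomD(2)[OF t] comp_ide_left[OF a] by auto
qed

text \<open>
  Here \<open>a\<close> and the zero arrow extend to a morphism from the trivial triangle
  \<open>W \<rightarrow> 0 \<rightarrow> \<Sigma>W = \<Sigma>W\<close> to the rotated triangle.  Its third component is
  the suspension of the factorization; the signs that the two rotations introduce cancel.
\<close>

lemma dist_weak_kernel:
  assumes d: "(f, g, h) \<in> Dist T" and f: "f \<in> Hom T X Y" and g: "g \<in> Hom T Y Z"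
    and a: "a \<in> Hom T W Y" and 0: "g \<cdot> a = ZeroArr T W Z"
  obtains b where "b \<in> Hom T W X" "a = f \<cdot> b"
proof -
  have h: "Dom T h = Z" using dist_triangle[OF d] g by (simp add: triangle_def Hom_def)
  obtain N where N: "zero_obj T N" using ex_zero_obj by blast
  have X: "X \<in> Obj T" and W: "W \<in> Obj T" and N': "N \<in> Obj T" and Z: "Z \<in> Obj T"
    using Hom_obj f a g N by (auto simp: zero_obj_def)
  let ?i = "ZeroArr T W N" and ?t = "ZeroArr T N (SuspObj T W)"
  let ?n = "\<lambda>A B. m_inv (hom_group T (SuspObj T A) (SuspObj T B))"
  have i: "?i \<in> Hom T W N" and t: "?t \<in> Hom T N (SuspObj T W)" and W1: "Ide T W \<in> Hom T W W"
    and z: "ZeroArr T N Z \<in> Hom T N Z"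
    using zero_hom W N' Z susp_obj ide_hom by auto
  have sf: "SuspArr T f \<in> Hom T (SuspObj T X) (SuspObj T Y)"
    and s1: "SuspArr T (Ide T W) \<in> Hom T (SuspObj T W) (SuspObj T W)"
    and sa: "SuspArr T a \<in> Hom T (SuspObj T W) (SuspObj T Y)"
    using susp_hom f W1 a by auto
  have d1: "(?i, ?t, ?n W W (SuspArr T (Ide T W))) \<in> Dist T"
    using dist_rotate_left[OF dist_ide[OF W N] W1] .
  have d2: "(g, h, ?n X Y (SuspArr T f)) \<in> Dist T"
    using dist_rotate_left[OF d f] .
  have "\<exists>c \<in> Hom T (Dom T (?n W W (SuspArr T (Ide T W)))) (Dom T (?n X Y (SuspArr T f))).
      h \<cdot> ZeroArr T N Z = c \<cdot> ?t \<and>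
      ?n X Y (SuspArr T f) \<cdot> c = SuspArr T a \<cdot> ?n W W (SuspArr T (Ide T W))"
  proof (rule dist_morphism[OF d1 d2])
    show "a \<in> Hom T (Dom T ?i) (Dom T g)" using a HomD(2)[OF g] HomD(2)[OF i] by simp
    show "ZeroArr T N Z \<in> Hom T (Dom T ?t) (Dom T h)" using z HomD(2)[OF t] h by simp
    show "g \<cdot> a = ZeroArr T N Z \<cdot> ?i" using comp_zero_right[OF z W] 0 by simp
  qed
  then obtain c where c: "c \<in> Hom T (SuspObj T W) (SuspObj T X)"
    and eq: "?n X Y (SuspArr T f) \<cdot> c = SuspArr T a \<cdot> ?n W W (SuspArr T (Ide T W))"
    using HomD(2)[OF neg_hom[OF s1]] HomD(2)[OF neg_hom[OF sf]] by auto
  obtain b where b: "b \<in> Hom T W X" "SuspArr T b = c" using susp_full[OF W X c] .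
  have "?n W Y (SuspArr T f \<cdot> c) = ?n W Y (SuspArr T a \<cdot> SuspArr T (Ide T W))"
    by (simp only: comp_neg_left[OF c sf, symmetric] eq comp_neg_right[OF s1 sa])
  then have "SuspArr T f \<cdot> c = SuspArr T a \<cdot> SuspArr T (Ide T W)"
    using neg_eq_iff[OF comp_hom[OF c sf] comp_hom[OF s1 sa]] by blast
  then have "SuspArr T (f \<cdot> b) = SuspArr T a"
    by (simp only: susp_comp[OF b(1) f] b(2) susp_comp[OF W1 a, symmetric] comp_ide_right[OF a])
  then have "a = f \<cdot> b" using susp_faithful[OF comp_hom[OF b(1) f] a] by simp
  then show ?thesis using that b(1) by blast
qed

end

section \<open>Phantom maps\<close>

text \<open>
  Coproducts are indexed by subsets of the type underlying \<open>\<kappa>\<close>; this transports any small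
  family to such an index set.
\<close>

lemma small_set_reindex:
  fixes \<kappa> :: "'u rel"
  assumes "|A| <o \<kappa>"
  obtains I :: "'u set" and e where "|I| <o \<kappa>" "bij_betw e I A"
proof -
  obtain I :: "'u set" where "|A| =o |I|" "|I| <o \<kappa>"
    using iffD1[OF internalize_card_of_ordLess assms] by blast
  moreover from this(1) obtain e where "bij_betw e I A"
    using card_of_ordIso[of I A] ordIso_symmetric by blast
  ultimately show thesis using that by blast
qed

lemma phantomD:
  assumes "phantom T \<C> f" "f \<in> Hom T X Y" "C \<in> \<C>" "g \<in> Hom T C X"
  shows "f \<cdot>\<^bsub>T\<^esub> g = ZeroArr T C Y"
  using assms by (auto simp: phantom_def Hom_def)

lemma phantomI:
  assumes "f \<in> Hom T X Y" "\<And>C g. C \<in> \<C> \<Longrightarrow> g \<in> Hom T C X \<Longrightarrow> f \<cdot>\<^bsub>T\<^esub> g = ZeroArr T C Y"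
  shows "phantom T \<C> f"
  using assms by (auto simp: phantom_def Hom_def)

lemma phantom_hom: "phantom T \<C> f \<Longrightarrow> f \<in> Hom T (Dom T f) (Cod T f)"
  by (simp add: phantom_def Hom_def)

locale perfect_generators = triangulated_category T
  for T :: "('o, 'm, 'x) triangulated_category_scheme" (structure) +
  fixes \<kappa> :: "'u rel" and \<C> :: "'o set"
  assumes inaccessible: "inaccessible \<kappa>"
    and locally_small: "locally_small T \<kappa>"
    and has_coproducts: "has_coproducts T \<kappa>"
    and essentially_small: "essentially_small T \<kappa> \<C>"
    and closed_susp: "closed_under_susp T \<C>"
    and closed_desusp: "closed_under_desusp T \<C>"
    and generates: "generates T \<C>"
    and perfect: "perfect T \<kappa> \<C>"
begin

lemma Cinfinite: "Cinfinite \<kappa>"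
  using inaccessible cinfinite_mono[OF ordLess_imp_ordLeq natLeq_cinfinite]
  unfolding inaccessible_def by blast

lemma C_obj: "C \<in> \<C> \<Longrightarrow> C \<in> Obj T"
  using generates unfolding generates_def by blast

lemma phantom_comp_left:
  assumes f: "phantom T \<C> f" "f \<in> Hom T X Y" and g: "g \<in> Hom T Y Z"
  shows "phantom T \<C> (g \<cdot> f)"
proof (rule phantomI[OF comp_hom[OF f(2) g]])
  fix C r assume C: "C \<in> \<C>" and r: "r \<in> Hom T C X"
  show "(g \<cdot> f) \<cdot> r = ZeroArr T C Z"
    by (simp only: comp_assoc[OF r f(2) g] phantomD[OF f C r] comp_zero_right[OF g C_obj[OF C]])
qed

lemma phantom_comp_right:
  assumes f: "phantom T \<C> f" "f \<in> Hom T X Y" and g: "g \<in> Hom T W X"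
  shows "phantom T \<C> (f \<cdot> g)"
proof (rule phantomI[OF comp_hom[OF g f(2)]])
  fix C r assume C: "C \<in> \<C>" and r: "r \<in> Hom T C W"
  show "(f \<cdot> g) \<cdot> r = ZeroArr T C Y"
    by (simp only: comp_assoc[OF r g f(2)] phantomD[OF f C comp_hom[OF r g]])
qed

text \<open>
  The projective objects relative to the ideal of phantom maps.
\<close>

definition phantom_projective :: "'o \<Rightarrow> bool" where
  "phantom_projective F \<longleftrightarrow> F \<in> Obj T \<and>
     (\<forall>f X Y b. phantom T \<C> f \<longrightarrow> f \<in> Hom T X Y \<longrightarrow> b \<in> Hom T F X \<longrightarrow> f \<cdot> b = ZeroArr T F Y)"

lemma phantom_projectiveD:
  "\<lbrakk>phantom_projective F; phantom T \<C> f; f \<in> Hom T X Y; b \<in> Hom T F X\<rbrakk> \<Longrightarrow> f \<cdot> b = ZeroArr T F Y"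
  unfolding phantom_projective_def by simp

lemma phantom_projective_iso:
  assumes C: "C \<in> \<C>" and i: "iso_obj T C F"
  shows "phantom_projective F"
proof -
  obtain u v where u: "u \<in> Hom T C F" and v: "v \<in> Hom T F C" and uv: "u \<cdot> v = Ide T F"
    by (rule iso_objE[OF i])
  have F: "F \<in> Obj T" by (rule Hom_obj(2)[OF u])
  have "f \<cdot> b = ZeroArr T F Y"
    if f: "phantom T \<C> f" "f \<in> Hom T X Y" and b: "b \<in> Hom T F X" for f X Y b
  proof -
    have "f \<cdot> b = f \<cdot> ((b \<cdot> u) \<cdot> v)"
      by (simp only: comp_assoc[OF v u b] uv comp_ide_right[OF b])
    also have "\<dots> = (f \<cdot> (b \<cdot> u)) \<cdot> v"
      by (rule comp_assoc[OF v comp_hom[OF u b] f(2), symmetric])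
    also have "\<dots> = ZeroArr T F Y"
      by (simp only: phantomD[OF f C comp_hom[OF u b]] comp_zero_left[OF v Hom_obj(2)[OF f(2)]])
    finally show ?thesis .
  qed
  then show ?thesis using F unfolding phantom_projective_def by simp
qed

lemma phantom_projective_coproduct:
  assumes P: "is_coproduct T I X P p" and X: "\<And>i. i \<in> I \<Longrightarrow> X i \<in> \<C>"
  shows "phantom_projective P"
proof -
  have PO: "P \<in> Obj T" and p: "\<And>i. i \<in> I \<Longrightarrow> p i \<in> Hom T (X i) P"
    using P by (auto simp: is_coproduct_def)
  have "f \<cdot> b = ZeroArr T P Z"
    if f: "phantom T \<C> f" "f \<in> Hom T Y Z" and b: "b \<in> Hom T P Y" for f Y Z b
  proof (rule coproduct_hom_eqI[OF P comp_hom[OF b f(2)] zero_hom[OF PO Hom_obj(2)[OF f(2)]]])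
    fix i assume i: "i \<in> I"
    show "(f \<cdot> b) \<cdot> p i = ZeroArr T P Z \<cdot> p i"
      by (simp only: comp_assoc[OF p[OF i] b f(2)] phantomD[OF f X[OF i] comp_hom[OF p[OF i] b]]
          comp_zero_left[OF p[OF i] Hom_obj(2)[OF f(2)]])
  qed
  then show ?thesis using PO unfolding phantom_projective_def by simp
qed

lemma phantom_projective_susp_coproduct:
  assumes P: "is_coproduct T I X P p" and X: "\<And>i. i \<in> I \<Longrightarrow> X i \<in> \<C>"
  shows "phantom_projective (SuspObj T P)"
proof -
  have PO: "P \<in> Obj T" and p: "\<And>i. i \<in> I \<Longrightarrow> p i \<in> Hom T (X i) P"
    using P by (auto simp: is_coproduct_def)
  have "f \<cdot> b = ZeroArr T (SuspObj T P) Z"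
    if f: "phantom T \<C> f" "f \<in> Hom T Y Z" and b: "b \<in> Hom T (SuspObj T P) Y" for f Y Z b
  proof (rule coproduct_susp_epi[OF P comp_hom[OF b f(2)]])
    fix i assume i: "i \<in> I"
    obtain C where "C \<in> \<C>" "iso_obj T C (SuspObj T (X i))"
      using closed_susp X[OF i] unfolding closed_under_susp_def by blast
    then have pr: "phantom_projective (SuspObj T (X i))" by (rule phantom_projective_iso)
    show "(f \<cdot> b) \<cdot> SuspArr T (p i) = ZeroArr T (SuspObj T (X i)) Z"
      by (simp only: comp_assoc[OF susp_hom[OF p[OF i]] b f(2)]
          phantom_projectiveD[OF pr f comp_hom[OF susp_hom[OF p[OF i]] b]])
  qed
  then show ?thesis using susp_obj[OF PO] unfolding phantom_projective_def by simp
qed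

text \<open>
  \<open>p\<close> is a cover of \<open>X\<close> by a relatively projective object and \<open>x\<close> is its cone.
  Projectivity of the suspension is what makes phantom maps kill arrows out of the cone that vanish
  on \<open>X\<close>.
\<close>

definition phantom_triangle :: "'o \<Rightarrow> 'm \<Rightarrow> 'm \<Rightarrow> 'm \<Rightarrow> bool" where
  "phantom_triangle X p x y \<longleftrightarrow> (p, x, y) \<in> Dist T \<and> Cod T p = X \<and>
     (\<forall>C\<in>\<C>. hom_surj T C p) \<and>
     phantom_projective (Dom T p) \<and> phantom_projective (SuspObj T (Dom T p))"

text \<open>
  The cover is the coproduct of the domains of all arrows to \<open>X\<close> from a small skeleton
  of \<open>\<C>\<close>.  There is only a small set of such arrows because \<open>T\<close> is locally small and \<open>\<kappa>\<close>
  is regular.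
\<close>

lemma ex_phantom_triangle:
  assumes X: "X \<in> Obj T"
  shows "\<exists>p x y. phantom_triangle X p x y"
proof -
  obtain \<D> where D: "\<D> \<subseteq> \<C>" "|\<D>| <o \<kappa>" and iso: "\<And>C. C \<in> \<C> \<Longrightarrow> \<exists>D\<in>\<D>. iso_obj T C D"
    using essentially_small unfolding essentially_small_def by blast
  define J where "J = (\<Union>D\<in>\<D>. Hom T D X)"
  have "\<forall>D\<in>\<D>. |Hom T D X| <o \<kappa>"
    using locally_small D(1) C_obj X unfolding locally_small_def by blast
  then have "|J| <o \<kappa>"
    unfolding J_def
    by (intro card_of_UNION_ordLess_infinite_Field_regularCard[OF _ Cinfinite D(2)])
       (use inaccessible in \<open>simp add: inaccessible_def\<close>)
  then obtain I :: "'u set" and e where I: "|I| <o \<kappa>" and e: "bij_betw e I J"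
    by (rule small_set_reindex)
  have ei: "e i \<in> Hom T (Dom T (e i)) X" "Dom T (e i) \<in> \<C>" if "i \<in> I" for i
  proof -
    have "e i \<in> J" using bij_betwE[OF e] that by simp
    then show "e i \<in> Hom T (Dom T (e i)) X" "Dom T (e i) \<in> \<C>"
      using D(1) unfolding J_def Hom_def by auto
  qed
  have "\<forall>i\<in>I. Dom T (e i) \<in> Obj T" using ei(2) C_obj by blast
  with I obtain P q where P: "is_coproduct T I (\<lambda>i. Dom T (e i)) P q"
    using has_coproducts unfolding has_coproducts_def by presburger
  obtain p where p: "p \<in> Hom T P X" and pq: "\<And>i. i \<in> I \<Longrightarrow> p \<cdot> q i = e i"
    using coproduct_map[OF P X ei(1)] by metis
  obtain x y where d: "(p, x, y) \<in> Dist T" using dist_embed HomD(1)[OF p] by blast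
  have "hom_surj T C p" if C: "C \<in> \<C>" for C
    unfolding hom_surj_def HomD(2)[OF p] HomD(3)[OF p]
  proof (intro equalityI subsetI)
    fix g assume "g \<in> (\<lambda>g. p \<cdot> g) ` Hom T C P"
    then show "g \<in> Hom T C X" using comp_hom[OF _ p] by blast
  next
    fix g assume g: "g \<in> Hom T C X"
    obtain D where D': "D \<in> \<D>" "iso_obj T C D" using iso[OF C] by blast
    obtain u v where u: "u \<in> Hom T C D" and v: "v \<in> Hom T D C" and vu: "v \<cdot> u = Ide T C"
      by (rule iso_objE[OF D'(2)])
    have gv: "g \<cdot> v \<in> Hom T D X" by (rule comp_hom[OF v g])
    then have "g \<cdot> v \<in> J" using D'(1) unfolding J_def by blast
    then obtain i where i: "i \<in> I" "g \<cdot> v = e i"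
      using bij_betw_imp_surj_on[OF e] by blast
    have "q i \<in> Hom T (Dom T (e i)) P" using P i(1) by (simp add: is_coproduct_def)
    then have q: "q i \<in> Hom T D P" using HomD(2)[OF gv] i(2) by simp
    have "g = (g \<cdot> v) \<cdot> u" by (simp only: comp_assoc[OF u v g] vu comp_ide_right[OF g])
    also have "\<dots> = p \<cdot> (q i \<cdot> u)" by (simp only: i(2) pq[OF i(1), symmetric] comp_assoc[OF u q p])
    finally show "g \<in> (\<lambda>g. p \<cdot> g) ` Hom T C P" using comp_hom[OF u q] by (rule image_eqI)
  qed
  then have "phantom_triangle X p x y"
    unfolding phantom_triangle_def
    using d HomD(2,3)[OF p] phantom_projective_coproduct[OF P ei(2)]
      phantom_projective_susp_coproduct[OF P ei(2)] by simp
  then show ?thesis by blast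
qed

definition phantom_envelope :: "'o \<Rightarrow> 'm" where
  "phantom_envelope X = (SOME x. \<exists>p y. phantom_triangle X p x y)"

lemma phantom_envelopeE:
  assumes "X \<in> Obj T"
  obtains p y F Z where "phantom_triangle X p (phantom_envelope X) y"
    "p \<in> Hom T F X" "phantom_envelope X \<in> Hom T X Z" "y \<in> Hom T Z (SuspObj T F)"
proof -
  have "\<exists>x. \<exists>p y. phantom_triangle X p x y" using ex_phantom_triangle[OF assms] by blast
  then have "\<exists>p y. phantom_triangle X p (phantom_envelope X) y"
    unfolding phantom_envelope_def by (rule someI_ex)
  then obtain p y where t: "phantom_triangle X p (phantom_envelope X) y" by blast
  then have d: "(p, phantom_envelope X, y) \<in> Dist T" "Cod T p = X" by (simp_all add: phantom_triangle_def)
  show thesis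
    by (rule distE[OF d(1)], rule that[OF t]) (use d(2) in \<open>auto simp: Hom_def\<close>)
qed

lemma phantom_envelope_hom:
  "X \<in> Obj T \<Longrightarrow> phantom_envelope X \<in> Hom T X (Cod T (phantom_envelope X))"
  by (erule phantom_envelopeE) (simp add: Hom_def)

text \<open>
  An arrow to \<open>X\<close> from an object of \<open>\<C>\<close> factors through the cover \<open>p\<close>, and
  consecutive arrows of a distinguished triangle compose to zero.
\<close>

lemma phantom_phantom_envelope:
  assumes "X \<in> Obj T"
  shows "phantom T \<C> (phantom_envelope X)"
proof -
  obtain p y F Z where t: "phantom_triangle X p (phantom_envelope X) y"
    and p: "p \<in> Hom T F X" and x: "phantom_envelope X \<in> Hom T X Z"
    using phantom_envelopeE[OF assms] by metis
  have d: "(p, phantom_envelope X, y) \<in> Dist T" using t by (simp add: phantom_triangle_def)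
  show ?thesis
  proof (rule phantomI[OF x])
    fix C g assume C: "C \<in> \<C>" and g: "g \<in> Hom T C X"
    have "(\<lambda>g. p \<cdot> g) ` Hom T C F = Hom T C X"
      using t C HomD(2,3)[OF p] unfolding phantom_triangle_def hom_surj_def by simp
    then obtain r where r: "r \<in> Hom T C F" "g = p \<cdot> r" using g by blast
    show "phantom_envelope X \<cdot> g = ZeroArr T C Z"
      by (simp only: r(2) comp_assoc[OF r(1) p x, symmetric] dist_comp_zero[OF d p x]
          comp_zero_left[OF r(1) Hom_obj(2)[OF x]])
  qed
qed

text \<open>
  A phantom map kills the projective cover of \<open>X\<close>, hence factors through the cone of the
  cover.
\<close>

lemma phantom_factors_through_envelope:
  assumes f: "phantom T \<C> f" "f \<in> Hom T X Y"
  obtains b where "b \<in> Hom T (Cod T (phantom_envelope X)) Y" "f = b \<cdot> phantom_envelope X"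
proof -
  have X: "X \<in> Obj T" by (rule Hom_obj(1)[OF f(2)])
  obtain p y F Z where t: "phantom_triangle X p (phantom_envelope X) y"
    and p: "p \<in> Hom T F X" and x: "phantom_envelope X \<in> Hom T X Z"
    using phantom_envelopeE[OF X] by metis
  have d: "(p, phantom_envelope X, y) \<in> Dist T" and F: "phantom_projective F"
    using t HomD(2)[OF p] by (simp_all add: phantom_triangle_def)
  show thesis
    using dist_weak_cokernel[OF d p x f(2) phantom_projectiveD[OF F f p]] that HomD(3)[OF x] by metis
qed

text \<open>
  Such an arrow \<open>a\<close> factors through the suspension of the projective cover, which is
  projective again.
\<close>

lemma phantom_kills_maps_vanishing_on_envelope:
  assumes X: "X \<in> Obj T" and a: "a \<in> Hom T (Cod T (phantom_envelope X)) Y"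
    and 0: "a \<cdot> phantom_envelope X = ZeroArr T X Y"
    and k: "phantom T \<C> k" "k \<in> Hom T Y W"
  shows "k \<cdot> a = ZeroArr T (Cod T (phantom_envelope X)) W"
proof -
  obtain p y F Z where t: "phantom_triangle X p (phantom_envelope X) y"
    and p: "p \<in> Hom T F X" and x: "phantom_envelope X \<in> Hom T X Z"
    and y: "y \<in> Hom T Z (SuspObj T F)"
    using phantom_envelopeE[OF X] by metis
  have d: "(p, phantom_envelope X, y) \<in> Dist T" and F: "phantom_projective (SuspObj T F)"
    using t HomD(2)[OF p] by (simp_all add: phantom_triangle_def)
  have a': "a \<in> Hom T Z Y" using a HomD(3)[OF x] by simp
  obtain b where b: "b \<in> Hom T (SuspObj T F) Y" "a = b \<cdot> y"
    by (rule dist_weak_cokernel[OF dist_rotate_left[OF d p] x y a' 0])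
  show ?thesis
    by (simp only: b(2) comp_assoc[OF y b(1) k(2), symmetric] phantom_projectiveD[OF F k b(1)]
        comp_zero_left[OF y Hom_obj(2)[OF k(2)]] HomD(3)[OF x])
qed

section \<open>The phantom tower\<close>

primrec stage :: "'o \<Rightarrow> nat \<Rightarrow> 'o" where
  "stage X 0 = X"
| "stage X (Suc n) = Cod T (phantom_envelope (stage X n))"

abbreviation step :: "'o \<Rightarrow> nat \<Rightarrow> 'm" where
  "step X n \<equiv> phantom_envelope (stage X n)"

primrec to_stage :: "'o \<Rightarrow> nat \<Rightarrow> 'm" where
  "to_stage X 0 = Ide T X"
| "to_stage X (Suc n) = step X n \<cdot> to_stage X n"

lemma stage_obj: "X \<in> Obj T \<Longrightarrow> stage X n \<in> Obj T"
proof (induction n)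
  case (Suc n)
  then show ?case using Hom_obj(2)[OF phantom_envelope_hom] by simp
qed simp

lemma step_hom: "X \<in> Obj T \<Longrightarrow> step X n \<in> Hom T (stage X n) (stage X (Suc n))"
  using phantom_envelope_hom[OF stage_obj] by simp

lemma step_phantom: "X \<in> Obj T \<Longrightarrow> phantom T \<C> (step X n)"
  by (rule phantom_phantom_envelope[OF stage_obj])

lemma to_stage_hom: "X \<in> Obj T \<Longrightarrow> to_stage X n \<in> Hom T X (stage X n)"
proof (induction n)
  case 0
  then show ?case using ide_hom by simp
next
  case (Suc n)
  show ?case using comp_hom[OF Suc.IH[OF Suc.prems] step_hom[OF Suc.prems]] by simp
qed

lemma n_phantom_to_stage:
  assumes X: "X \<in> Obj T"
  shows "n_phantom T \<C> (Suc n) (to_stage X (Suc n))"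
proof (induction n)
  case 0
  have "to_stage X (Suc 0) = step X 0" using comp_ide_right[OF step_hom[OF X, of 0]] by simp
  then show ?case using n_phantom.one[OF step_phantom[OF X, of 0]] by simp
next
  case (Suc n)
  have "n_phantom T \<C> (Suc (Suc n)) (step X (Suc n) \<cdot> to_stage X (Suc n))"
    by (rule n_phantom.comp[OF step_phantom[OF X] Suc.IH])
       (simp only: HomD(3)[OF to_stage_hom[OF X]] HomD(2)[OF step_hom[OF X]])
  then show ?case by simp
qed

lemma n_phantom_hom: "n_phantom T \<C> n f \<Longrightarrow> f \<in> Hom T (Dom T f) (Cod T f)"
proof (induction rule: n_phantom.induct)
  case (one f)
  then show ?case by (rule phantom_hom)
next
  case (comp f n g)
  have "f \<cdot> g \<in> Hom T (Dom T g) (Cod T f)"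
    using comp_hom[of g "Dom T g" "Dom T f" f "Cod T f"] phantom_hom[OF comp.hyps(1)] comp.IH comp.hyps(3) by simp
  then show ?case by (simp add: Hom_def)
qed

lemma n_phantom_comp_left:
  assumes "n_phantom T \<C> n f" "f \<in> Hom T X Y" "g \<in> Hom T Y Z"
  shows "n_phantom T \<C> n (g \<cdot> f)"
  using assms(1)
proof (cases rule: n_phantom.cases)
  case one
  then show ?thesis using n_phantom.one[OF phantom_comp_left[OF _ assms(2,3)]] by simp
next
  case (comp k m l)
  have l: "l \<in> Hom T (Dom T l) (Dom T k)" and k: "k \<in> Hom T (Dom T k) (Cod T k)"
    using n_phantom_hom[OF comp(4)] comp(5) phantom_hom[OF comp(3)] by simp_all
  have g: "g \<in> Hom T (Cod T k) Z"
    using assms(2,3) comp_hom[OF l k] comp(2) by (simp add: Hom_def)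
  have "n_phantom T \<C> (Suc m) ((g \<cdot> k) \<cdot> l)"
    by (rule n_phantom.comp[OF phantom_comp_left[OF comp(3) k g] comp(4)])
       (simp only: comp(5) HomD(2)[OF comp_hom[OF k g]])
  then show ?thesis using comp_assoc[OF l k g] comp(1,2) by simp
qed

lemma n_phantom_comp_right:
  "\<lbrakk>n_phantom T \<C> n f; f \<in> Hom T X Y; g \<in> Hom T W X\<rbrakk> \<Longrightarrow> n_phantom T \<C> n (f \<cdot> g)"
proof (induction arbitrary: Y rule: n_phantom.induct)
  case (one f)
  then show ?case by (intro n_phantom.one phantom_comp_right)
next
  case (comp k m l)
  have l: "l \<in> Hom T (Dom T l) (Dom T k)" and k: "k \<in> Hom T (Dom T k) (Cod T k)"
    using n_phantom_hom[OF comp.hyps(2)] comp.hyps(3) phantom_hom[OF comp.hyps(1)] by simp_all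
  have X: "Dom T l = X" using comp.prems(1) comp_hom[OF l k] by (simp add: Hom_def)
  have g: "g \<in> Hom T W (Dom T l)" using comp.prems(2) X by simp
  have "n_phantom T \<C> (Suc m) (k \<cdot> (l \<cdot> g))"
    by (rule n_phantom.comp[OF comp.hyps(1) comp.IH])
       (use l X comp.prems(2) HomD(3)[OF comp_hom[OF g l]] in simp_all)
  then show ?case using comp_assoc[OF g l k] by simp
qed

text \<open>
  If \<open>l = c j\<^sub>m\<close> for the first \<open>m\<close> factors \<open>l\<close> of the map, then composing \<open>c\<close> with
  the last factor is a phantom map out of \<open>X\<^sub>m\<close>, which factors through the next step.
\<close>

lemma n_phantom_factors_through_stage:
  "\<lbrakk>n_phantom T \<C> n f; f \<in> Hom T X Y\<rbrakk>
    \<Longrightarrow> \<exists>b \<in> Hom T (stage X n) Y. f = b \<cdot> to_stage X n"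
proof (induction arbitrary: Y rule: n_phantom.induct)
  case (one f)
  have X: "X \<in> Obj T" by (rule Hom_obj(1)[OF one.prems])
  obtain b where b: "b \<in> Hom T (Cod T (phantom_envelope X)) Y" "f = b \<cdot> phantom_envelope X"
    by (rule phantom_factors_through_envelope[OF one.hyps one.prems])
  have "b \<in> Hom T (stage X 1) Y" using b(1) by simp
  moreover have "to_stage X 1 = phantom_envelope X"
    using comp_ide_right[OF phantom_envelope_hom[OF X]] by simp
  ultimately show ?case using b(2) by metis
next
  case (comp k m l)
  have l: "l \<in> Hom T (Dom T l) (Dom T k)" and k: "k \<in> Hom T (Dom T k) (Cod T k)"
    using n_phantom_hom[OF comp.hyps(2)] comp.hyps(3) phantom_hom[OF comp.hyps(1)] by simp_all
  have eq: "Dom T l = X" "Cod T k = Y" using comp.prems comp_hom[OF l k] by (simp_all add: Hom_def)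
  have l': "l \<in> Hom T X (Dom T k)" and k': "k \<in> Hom T (Dom T k) Y" using l k eq by simp_all
  have X: "X \<in> Obj T" by (rule Hom_obj(1)[OF l'])
  obtain c where c: "c \<in> Hom T (stage X m) (Dom T k)" "l = c \<cdot> to_stage X m"
    using comp.IH[OF l'] by blast
  have kc: "k \<cdot> c \<in> Hom T (stage X m) Y" by (rule comp_hom[OF c(1) k'])
  obtain b where b: "b \<in> Hom T (Cod T (step X m)) Y" "k \<cdot> c = b \<cdot> step X m"
    by (rule phantom_factors_through_envelope[OF phantom_comp_right[OF comp.hyps(1) k' c(1)] kc])
  have b': "b \<in> Hom T (stage X (Suc m)) Y" using b(1) by simp
  have "k \<cdot> l = (k \<cdot> c) \<cdot> to_stage X m"
    by (simp only: c(2) comp_assoc[OF to_stage_hom[OF X] c(1) k'])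
  also have "\<dots> = b \<cdot> to_stage X (Suc m)"
    by (simp only: b(2) comp_assoc[OF to_stage_hom[OF X] step_hom[OF X] b'] to_stage.simps)
  finally show ?case using b' by blast
qed

text \<open>
  Write \<open>k l\<close> for the \<open>(m+1)\<close>-phantom map, with \<open>k\<close> phantom and \<open>l\<close> an
  \<open>m\<close>-phantom map.  By induction \<open>l\<close> kills \<open>a x\<^sub>m\<close>, so \<open>l a\<close> vanishes on the step
  \<open>x\<^sub>m\<close> and is killed by \<open>k\<close>.
\<close>

lemma n_phantom_kills_maps_vanishing_on_source:
  assumes X: "X \<in> Obj T"
  shows "\<lbrakk>n_phantom T \<C> n k; k \<in> Hom T Y W; a \<in> Hom T (stage X n) Y;
    a \<cdot> to_stage X n = ZeroArr T X Y\<rbrakk> \<Longrightarrow> k \<cdot> a = ZeroArr T (stage X n) W"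
proof (induction arbitrary: a Y W rule: n_phantom.induct)
  case (one k)
  have x: "to_stage X 1 = phantom_envelope X"
    using comp_ide_right[OF phantom_envelope_hom[OF X]] by simp
  show ?case
    using phantom_kills_maps_vanishing_on_envelope[OF X _ _ one.hyps one.prems(1), of a]
      one.prems(2,3) x by simp
next
  case (comp k m l)
  have l0: "l \<in> Hom T (Dom T l) (Dom T k)" and k0: "k \<in> Hom T (Dom T k) (Cod T k)"
    using n_phantom_hom[OF comp.hyps(2)] comp.hyps(3) phantom_hom[OF comp.hyps(1)] by simp_all
  have eq: "Dom T l = Y" "Cod T k = W"
    using comp.prems(1) comp_hom[OF l0 k0] by (simp_all add: Hom_def)
  have l: "l \<in> Hom T Y (Dom T k)" and k: "k \<in> Hom T (Dom T k) W" using l0 k0 eq by simp_all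
  note a = comp.prems(2)
  note s = step_hom[OF X, of m] and j = to_stage_hom[OF X, of m]
  have "(a \<cdot> step X m) \<cdot> to_stage X m = ZeroArr T X Y"
    using comp.prems(3) by (simp only: comp_assoc[OF j s a] to_stage.simps)
  then have "l \<cdot> (a \<cdot> step X m) = ZeroArr T (stage X m) (Dom T k)"
    by (rule comp.IH[OF l comp_hom[OF s a]])
  then have "(l \<cdot> a) \<cdot> step X m = ZeroArr T (stage X m) (Dom T k)"
    by (simp only: comp_assoc[OF s a l])
  moreover have "l \<cdot> a \<in> Hom T (Cod T (step X m)) (Dom T k)"
    using comp_hom[OF a l] by simp
  ultimately have "k \<cdot> (l \<cdot> a) = ZeroArr T (Cod T (step X m)) W"
    using phantom_kills_maps_vanishing_on_envelope[OF stage_obj[OF X] _ _ comp.hyps(1) k] by blast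
  then show ?case by (simp only: comp_assoc[OF a l k] stage.simps)
qed

lemma ex_cover:
  assumes "X \<in> Obj T"
  shows "\<exists>f. f \<in> Hom T (Dom T f) X \<and> (\<forall>C\<in>\<C>. hom_surj T C f) \<and> phantom_projective (Dom T f)"
proof -
  obtain p x y where t: "phantom_triangle X p x y" using ex_phantom_triangle[OF assms] by blast
  then have "p \<in> Arr T" "Cod T p = X"
    using dist_triangle unfolding phantom_triangle_def triangle_def by blast+
  then show ?thesis using t unfolding phantom_triangle_def Hom_def by blast
qed

text \<open>
  This is where perfection enters: the coproduct \<open>h\<close> of covers of the \<open>X i\<close> is surjective on
  arrows from \<open>\<C>\<close>, so it suffices that \<open>s h = 0\<close>; this is checked on each summand, where it
  holds because the cover is projective.
\<close>

lemma phantom_from_coproduct: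
  fixes I :: "'u set"
  assumes I: "|I| <o \<kappa>" and P: "is_coproduct T I X P p" and s: "s \<in> Hom T P Q"
    and ph: "\<And>i. i \<in> I \<Longrightarrow> phantom T \<C> (s \<cdot> p i)"
  shows "phantom T \<C> s"
proof -
  have XO: "\<And>i. i \<in> I \<Longrightarrow> X i \<in> Obj T" and p: "\<And>i. i \<in> I \<Longrightarrow> p i \<in> Hom T (X i) P"
    using P by (auto simp: is_coproduct_def)
  have "\<forall>i\<in>I. \<exists>f. f \<in> Hom T (Dom T f) (X i) \<and> (\<forall>C\<in>\<C>. hom_surj T C f) \<and> phantom_projective (Dom T f)"
    using ex_cover[OF XO] by blast
  then obtain f where f0: "\<forall>i\<in>I. f i \<in> Hom T (Dom T (f i)) (X i) \<and>
      (\<forall>C\<in>\<C>. hom_surj T C (f i)) \<and> phantom_projective (Dom T (f i))"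
    by (rule bchoice[THEN exE])
  then have f: "f i \<in> Hom T (Dom T (f i)) (X i)" "\<And>C. C \<in> \<C> \<Longrightarrow> hom_surj T C (f i)"
    "phantom_projective (Dom T (f i))" if "i \<in> I" for i
    using that by simp_all
  have "\<forall>i\<in>I. Dom T (f i) \<in> Obj T" using Hom_obj(1)[OF f(1)] by simp
  with I obtain F q where F: "is_coproduct T I (\<lambda>i. Dom T (f i)) F q"
    using has_coproducts unfolding has_coproducts_def by presburger
  have q: "\<And>i. i \<in> I \<Longrightarrow> q i \<in> Hom T (Dom T (f i)) F" and FO: "F \<in> Obj T"
    using F by (auto simp: is_coproduct_def)
  have PO: "P \<in> Obj T" by (rule Hom_obj(1)[OF s])
  obtain h where h: "h \<in> Hom T F P" "\<And>i. i \<in> I \<Longrightarrow> h \<cdot> q i = p i \<cdot> f i"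
    using coproduct_map[OF F PO comp_hom[OF f(1) p]] by metis
  have "is_coproduct T I (\<lambda>i. Cod T (f i)) P p"
    by (rule iffD2[OF is_coproduct_cong P]) (rule HomD(3)[OF f(1)])
  then have "is_coproduct_arr T I f F q P p h"
    unfolding is_coproduct_arr_def using F h HomD(1)[OF f(1)] by simp
  then have surj: "hom_surj T C h" if "C \<in> \<C>" for C
    using perfect that I HomD(1)[OF f(1)] f(2) unfolding perfect_def by blast
  have sh: "s \<cdot> h = ZeroArr T F Q"
  proof (rule coproduct_hom_eqI[OF F comp_hom[OF h(1) s] zero_hom[OF FO Hom_obj(2)[OF s]]])
    fix i assume i: "i \<in> I"
    have "(s \<cdot> h) \<cdot> q i = (s \<cdot> p i) \<cdot> f i"
      by (simp only: comp_assoc[OF q[OF i] h(1) s] h(2)[OF i] comp_assoc[OF f(1)[OF i] p[OF i] s])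
    also have "\<dots> = ZeroArr T (Dom T (f i)) Q"
      by (rule phantom_projectiveD[OF f(3)[OF i] ph[OF i] comp_hom[OF p[OF i] s] f(1)[OF i]])
    finally show "(s \<cdot> h) \<cdot> q i = ZeroArr T F Q \<cdot> q i"
      by (simp only: comp_zero_left[OF q[OF i] Hom_obj(2)[OF s]])
  qed
  show ?thesis
  proof (rule phantomI[OF s])
    fix C g assume C: "C \<in> \<C>" and g: "g \<in> Hom T C P"
    have "g \<in> (\<lambda>g. h \<cdot> g) ` Hom T C F"
      using surj[OF C] g HomD(2,3)[OF h(1)] by (simp add: hom_surj_def)
    then obtain r where r: "r \<in> Hom T C F" "g = h \<cdot> r" by blast
    show "s \<cdot> g = ZeroArr T C Q"
      by (simp only: r(2) comp_assoc[OF r(1) h(1) s, symmetric] sh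
          comp_zero_left[OF r(1) Hom_obj(2)[OF s]])
  qed
qed

text \<open>
  In other words \<open>d = 1 - s\<close> is an epimorphism.  As \<open>s\<close> is phantom, \<open>d g = g\<close> for every
  \<open>g\<close> from an object of \<open>\<C>\<close>, also after desuspension.  The long exact sequence then shows
  that there are no non-zero arrows from \<open>\<C>\<close> to the cone \<open>K\<close> of \<open>d\<close>.  Since \<open>\<C>\<close>
  generates, \<open>K\<close> is a zero object.
\<close>

lemma fixed_by_phantom_zero:
  assumes s: "phantom T \<C> s" "s \<in> Hom T P P" and m: "m \<in> Hom T P Z" and ms: "m \<cdot> s = m"
  shows "m = ZeroArr T P Z"
proof -
  have PO: "P \<in> Obj T" by (rule Hom_obj(1)[OF m])
  define d where "d = Add T (Ide T P) (inv\<^bsub>hom_group T P P\<^esub> s)"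
  note one = ide_hom[OF PO] and ns = neg_hom[OF s(2)]
  have d: "d \<in> Hom T P P" unfolding d_def by (rule add_hom[OF one ns])
  have dg: "d \<cdot> g = g" if C: "C \<in> \<C>" and g: "g \<in> Hom T C P" for C g
    by (simp only: d_def comp_add_left[OF g one ns] comp_neg_left[OF g s(2)] phantomD[OF s C g]
        comp_ide_left[OF g] neg_zero[OF C_obj[OF C] PO] add_zero_right[OF g])
  have md: "m \<cdot> d = ZeroArr T P Z"
    by (simp only: d_def comp_add_right[OF one ns m] comp_ide_right[OF m] comp_neg_right[OF s(2) m]
        ms add_neg[OF m])
  obtain u v where D: "(d, u, v) \<in> Dist T" using dist_embed[OF HomD(1)[OF d]] by blast
  obtain A B K where "d \<in> Hom T A B" and u0: "u \<in> Hom T B K" and v0: "v \<in> Hom T K (SuspObj T A)"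
    by (rule distE[OF D])
  then have "A = P" "B = P" using d by (auto simp: Hom_def)
  then have u: "u \<in> Hom T P K" and v: "v \<in> Hom T K (SuspObj T P)" using u0 v0 by simp_all
  have KO: "K \<in> Obj T" by (rule Hom_obj(2)[OF u])
  note sd = susp_hom[OF d]
  note nsd = neg_hom[OF sd]
  note rot = dist_rotate_left[OF D d]
  have vd: "inv\<^bsub>hom_group T (SuspObj T P) (SuspObj T P)\<^esub> (SuspArr T d) \<cdot> v
      = ZeroArr T K (SuspObj T P)"
    by (rule dist_comp_zero[OF dist_rotate_left[OF rot u] v nsd])
  have "g = ZeroArr T C K" if C: "C \<in> \<C>" and g: "g \<in> Hom T C K" for C g
  proof -
    \<comment> \<open>\<open>v g = 0\<close>: since \<open>\<Sigma>d v = 0\<close> and \<open>d\<close> fixes the desuspension \<open>r\<close> of \<open>v g a\<close>, \<open>\<Sigma>r = 0\<close>\<close>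
    obtain C' where C': "C' \<in> \<C>" "iso_obj T (SuspObj T C') C"
      using closed_desusp C unfolding closed_under_desusp_def by blast
    obtain a b where a: "a \<in> Hom T (SuspObj T C') C" and b: "b \<in> Hom T C (SuspObj T C')"
      and ab: "a \<cdot> b = Ide T C"
      by (rule iso_objE[OF C'(2)])
    have vg: "v \<cdot> g \<in> Hom T C (SuspObj T P)" by (rule comp_hom[OF g v])
    have ga: "g \<cdot> a \<in> Hom T (SuspObj T C') K" by (rule comp_hom[OF a g])
    obtain r where r: "r \<in> Hom T C' P" "SuspArr T r = v \<cdot> (g \<cdot> a)"
      by (rule susp_full[OF C_obj[OF C'(1)] PO comp_hom[OF ga v]])
    note sr = susp_hom[OF r(1)] and sC = susp_obj[OF C_obj[OF C'(1)]] and sP = susp_obj[OF PO]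
    have "inv\<^bsub>hom_group T (SuspObj T C') (SuspObj T P)\<^esub> (SuspArr T r)
        = inv\<^bsub>hom_group T (SuspObj T C') (SuspObj T P)\<^esub> (SuspArr T d \<cdot> SuspArr T r)"
      by (simp only: susp_comp[OF r(1) d, symmetric] dg[OF C'(1) r(1)])
    also have "\<dots> = inv\<^bsub>hom_group T (SuspObj T P) (SuspObj T P)\<^esub> (SuspArr T d) \<cdot> (v \<cdot> (g \<cdot> a))"
      by (simp only: comp_neg_left[OF sr sd] r(2)[symmetric])
    also have "\<dots> = ZeroArr T (SuspObj T C') (SuspObj T P)"
      by (simp only: comp_assoc[OF ga v nsd, symmetric] vd comp_zero_left[OF ga sP])
    finally have "SuspArr T r = ZeroArr T (SuspObj T C') (SuspObj T P)"
      using neg_neg[OF sr] neg_zero[OF sC sP] by simp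
    then have 0: "v \<cdot> (g \<cdot> a) = ZeroArr T (SuspObj T C') (SuspObj T P)" using r(2) by simp
    \<comment> \<open>undo the isomorphism between \<open>C\<close> and the suspension of \<open>C'\<close>\<close>
    have "v \<cdot> g = (v \<cdot> (g \<cdot> a)) \<cdot> b"
      by (simp only: comp_assoc[OF b ga v] comp_assoc[OF b a g] ab comp_ide_right[OF g])
    also have "\<dots> = ZeroArr T C (SuspObj T P)" by (simp only: 0 comp_zero_left[OF b sP])
    finally have vg0: "v \<cdot> g = ZeroArr T C (SuspObj T P)" .
    obtain t where t: "t \<in> Hom T C P" "g = u \<cdot> t"
      by (rule dist_weak_kernel[OF rot u v g vg0])
    \<comment> \<open>\<open>d\<close> fixes \<open>t\<close>, and \<open>u d = 0\<close>\<close>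
    have "g = u \<cdot> (d \<cdot> t)" by (simp only: dg[OF C t(1)] t(2))
    also have "\<dots> = ZeroArr T C K"
      by (simp only: comp_assoc[OF t(1) d u, symmetric] dist_comp_zero[OF D d u]
          comp_zero_left[OF t(1) KO])
    finally show ?thesis .
  qed
  then have "\<forall>C\<in>\<C>. Hom T C K = {ZeroArr T C K}" using zero_hom[OF C_obj KO] by blast
  then have K0: "zero_obj T K" using generates KO unfolding generates_def by blast
  obtain c where c: "c \<in> Hom T K Z" "m = c \<cdot> u"
    by (rule dist_weak_cokernel[OF D d u m md])
  have ZO: "Z \<in> Obj T" by (rule Hom_obj(2)[OF m])
  have "c = ZeroArr T K Z" by (rule hom_zero_obj_eq(2)[OF K0 c(1) zero_hom[OF KO ZO]])
  then show ?thesis by (simp only: c(2) comp_zero_left[OF u ZO])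
qed

text \<open>
  The family is an arrow \<open>w\<close> from the coproduct of all stages, and compatibility says
  that \<open>w s = w\<close> for the shift \<open>s\<close>.  The components of \<open>s\<close> are tower steps followed by
  coproduct arrows, so \<open>s\<close> is a phantom map.
\<close>

lemma compatible_maps_from_tower_zero:
  assumes X: "X \<in> Obj T" and m: "\<And>n. m n \<in> Hom T (stage X n) Z"
    and comp: "\<And>n. m (Suc n) \<cdot> step X n = m n"
  shows "m n = ZeroArr T (stage X n) Z"
proof -
  have ZO: "Z \<in> Obj T" by (rule Hom_obj(2)[OF m])
  have "|UNIV :: nat set| <o \<kappa>"
    using inaccessible ordIso_ordLess_trans[OF card_of_nat] unfolding inaccessible_def by blast
  then obtain I :: "'u set" and e :: "'u \<Rightarrow> nat" where I: "|I| <o \<kappa>" and e: "bij_betw e I UNIV"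
    by (rule small_set_reindex)
  \<comment> \<open>\<open>e\<close> numbers the index set by the stages of the tower, \<open>r\<close> is its inverse\<close>
  define r where "r = the_inv_into I e"
  have r: "r n \<in> I" "e (r n) = n" for n
    using the_inv_into_into[OF bij_betw_imp_inj_on[OF e], of n I]
      f_the_inv_into_f[OF bij_betw_imp_inj_on[OF e], of n] bij_betw_imp_surj_on[OF e]
    unfolding r_def by simp_all
  have "\<forall>i\<in>I. stage X (e i) \<in> Obj T" using stage_obj[OF X] by blast
  with I obtain P p where P: "is_coproduct T I (\<lambda>i. stage X (e i)) P p"
    using has_coproducts unfolding has_coproducts_def by presburger
  have PO: "P \<in> Obj T" and p: "\<And>i. i \<in> I \<Longrightarrow> p i \<in> Hom T (stage X (e i)) P"
    using P by (auto simp: is_coproduct_def)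
  have pr: "p (r n) \<in> Hom T (stage X n) P" for n using p[OF r(1)] r(2) by simp
  obtain s where s: "s \<in> Hom T P P"
    and sp: "\<And>i. i \<in> I \<Longrightarrow> s \<cdot> p i = p (r (Suc (e i))) \<cdot> step X (e i)"
    using coproduct_map[OF P PO, of "\<lambda>i. p (r (Suc (e i))) \<cdot> step X (e i)"]
      comp_hom[OF step_hom[OF X] pr] by metis
  have "phantom T \<C> s"
  proof (rule phantom_from_coproduct[OF I P s])
    fix i assume "i \<in> I"
    show "phantom T \<C> (s \<cdot> p i)"
      by (simp only: sp[OF \<open>i \<in> I\<close>] phantom_comp_left[OF step_phantom[OF X] step_hom[OF X] pr])
  qed
  moreover obtain w where w: "w \<in> Hom T P Z" and wp: "\<And>i. i \<in> I \<Longrightarrow> w \<cdot> p i = m (e i)"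
    using coproduct_map[OF P ZO, of "\<lambda>i. m (e i)"] m by metis
  moreover have "w \<cdot> s = w"
  proof (rule coproduct_hom_eqI[OF P comp_hom[OF s w] w])
    fix i assume i: "i \<in> I"
    show "(w \<cdot> s) \<cdot> p i = w \<cdot> p i"
      by (simp only: comp_assoc[OF p[OF i] s w] sp[OF i] comp_assoc[OF step_hom[OF X] pr w, symmetric]
          wp[OF r(1)] r(2) wp[OF i] comp)
  qed
  ultimately have w0: "w = ZeroArr T P Z" using fixed_by_phantom_zero s by blast
  have "m n = w \<cdot> p (r n)" by (simp only: wp[OF r(1)] r(2))
  also have "\<dots> = ZeroArr T (stage X n) Z" by (simp only: w0 comp_zero_left[OF pr ZO])
  finally show ?thesis .
qed

section \<open>The ideal of \<open>\<infinity>\<close>-phantom maps\<close>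

lemma n_phantom_iff:
  assumes f: "f \<in> Hom T X Y" and n: "0 < n"
  shows "n_phantom T \<C> n f \<longleftrightarrow> (\<exists>b \<in> Hom T (stage X n) Y. f = b \<cdot> to_stage X n)"
proof
  show "\<exists>b \<in> Hom T (stage X n) Y. f = b \<cdot> to_stage X n" if "n_phantom T \<C> n f"
    by (rule n_phantom_factors_through_stage[OF that f])
next
  have X: "X \<in> Obj T" by (rule Hom_obj(1)[OF f])
  assume "\<exists>b \<in> Hom T (stage X n) Y. f = b \<cdot> to_stage X n"
  then obtain b where b: "b \<in> Hom T (stage X n) Y" "f = b \<cdot> to_stage X n" by blast
  obtain k where "n = Suc k" using n gr0_implies_Suc by blast
  then have "n_phantom T \<C> n (to_stage X n)" using n_phantom_to_stage[OF X] by blast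
  then show "n_phantom T \<C> n f"
    using n_phantom_comp_left[OF _ to_stage_hom[OF X] b(1)] b(2) by simp
qed

lemma infinity_phantoms_iff:
  assumes "f \<in> Hom T X Y"
  shows "f \<in> infinity_phantoms T \<C> \<longleftrightarrow>
    (\<forall>n>0. \<exists>b \<in> Hom T (stage X n) Y. f = b \<cdot> to_stage X n)"
  using n_phantom_iff[OF assms] unfolding infinity_phantoms_def by simp

lemma ideal_infinity_phantoms: "ideal T (infinity_phantoms T \<C>)"
  unfolding ideal_def
proof (intro conjI ballI impI)
  let ?J = "infinity_phantoms T \<C>"
  show J: "?J \<subseteq> Arr T"
  proof
    fix f assume "f \<in> ?J"
    then have "n_phantom T \<C> 1 f" by (simp add: infinity_phantoms_def)
    then show "f \<in> Arr T" by (rule HomD(1)[OF n_phantom_hom])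
  qed
  fix X Y assume X: "X \<in> Obj T" and Y: "Y \<in> Obj T"
  interpret G: comm_group "hom_group T X Y" by (rule hom_comm_group[OF X Y])
  note j = to_stage_hom[OF X]
  show "subgroup (?J \<inter> Hom T X Y) (hom_group T X Y)"
  proof (rule G.subgroupI)
    show "?J \<inter> Hom T X Y \<subseteq> carrier (hom_group T X Y)" by simp
    have "ZeroArr T X Y \<in> ?J"
      unfolding infinity_phantoms_iff[OF zero_hom[OF X Y]]
      using comp_zero_left[OF j Y] zero_hom[OF stage_obj[OF X] Y] by metis
    then show "?J \<inter> Hom T X Y \<noteq> {}" using zero_hom[OF X Y] by blast
  next
    fix f assume "f \<in> ?J \<inter> Hom T X Y"
    then have f: "f \<in> ?J" "f \<in> Hom T X Y" by simp_all
    have "inv\<^bsub>hom_group T X Y\<^esub> f \<in> ?J"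
      unfolding infinity_phantoms_iff[OF neg_hom[OF f(2)]]
    proof (intro allI impI)
      fix n :: nat assume "0 < n"
      then obtain b where b: "b \<in> Hom T (stage X n) Y" "f = b \<cdot> to_stage X n"
        using f(1) unfolding infinity_phantoms_iff[OF f(2)] by blast
      have "inv\<^bsub>hom_group T X Y\<^esub> f = inv\<^bsub>hom_group T (stage X n) Y\<^esub> b \<cdot> to_stage X n"
        by (simp only: b(2) comp_neg_left[OF j b(1)])
      then show "\<exists>b \<in> Hom T (stage X n) Y. inv\<^bsub>hom_group T X Y\<^esub> f = b \<cdot> to_stage X n"
        using neg_hom[OF b(1)] by (rule bexI)
    qed
    then show "inv\<^bsub>hom_group T X Y\<^esub> f \<in> ?J \<inter> Hom T X Y" using neg_hom[OF f(2)] by blast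
  next
    fix f g assume "f \<in> ?J \<inter> Hom T X Y" "g \<in> ?J \<inter> Hom T X Y"
    then have f: "f \<in> ?J" "f \<in> Hom T X Y" and g: "g \<in> ?J" "g \<in> Hom T X Y" by simp_all
    have "Add T f g \<in> ?J"
      unfolding infinity_phantoms_iff[OF add_hom[OF f(2) g(2)]]
    proof (intro allI impI)
      fix n :: nat assume n: "0 < n"
      obtain b where b: "b \<in> Hom T (stage X n) Y" "f = b \<cdot> to_stage X n"
        using f(1) n unfolding infinity_phantoms_iff[OF f(2)] by blast
      obtain c where c: "c \<in> Hom T (stage X n) Y" "g = c \<cdot> to_stage X n"
        using g(1) n unfolding infinity_phantoms_iff[OF g(2)] by blast
      have "Add T f g = Add T b c \<cdot> to_stage X n"
        by (simp only: b(2) c(2) comp_add_left[OF j b(1) c(1)])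
      then show "\<exists>b \<in> Hom T (stage X n) Y. Add T f g = b \<cdot> to_stage X n"
        using add_hom[OF b(1) c(1)] by (rule bexI)
    qed
    then show "f \<otimes>\<^bsub>hom_group T X Y\<^esub> g \<in> ?J \<inter> Hom T X Y" using add_hom[OF f(2) g(2)] by simp
  qed
next
  let ?J = "infinity_phantoms T \<C>"
  fix f g assume f: "f \<in> ?J" and g: "g \<in> Arr T"
  have "n_phantom T \<C> 1 f" using f by (simp add: infinity_phantoms_def)
  then have fh: "f \<in> Hom T (Dom T f) (Cod T f)" by (rule n_phantom_hom)
  show "g \<cdot> f \<in> ?J" if "Dom T g = Cod T f"
    using f n_phantom_comp_left[OF _ fh HomI[OF g that refl]] unfolding infinity_phantoms_def by blast
  show "f \<cdot> g \<in> ?J" if "Cod T g = Dom T f"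
    using f n_phantom_comp_right[OF _ fh HomI[OF g refl that]] unfolding infinity_phantoms_def by blast
qed

text \<open>
  Factorizations \<open>H n\<close> of \<open>h\<close> through the stages need not be compatible, but after
  composition with \<open>k\<close> they are.
\<close>

lemma infinity_phantoms_square_zero:
  assumes h: "h \<in> infinity_phantoms T \<C>" "h \<in> Hom T X Y"
    and k: "k \<in> infinity_phantoms T \<C>" "k \<in> Hom T Y Z"
  shows "k \<cdot> h = ZeroArr T X Z"
proof -
  have X: "X \<in> Obj T" and Y: "Y \<in> Obj T" using Hom_obj[OF h(2)] by simp_all
  have ZO: "Z \<in> Obj T" by (rule Hom_obj(2)[OF k(2)])
  have "\<exists>b. b \<in> Hom T (stage X n) Y \<and> b \<cdot> to_stage X n = h" for n
  proof (cases n)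
    case 0
    then show ?thesis using h(2) comp_ide_right[OF h(2)] by auto
  next
    case (Suc l)
    then show ?thesis using h(1) unfolding infinity_phantoms_iff[OF h(2)] by (metis zero_less_Suc)
  qed
  then obtain H where H: "\<And>n. H n \<in> Hom T (stage X n) Y" and Hh: "\<And>n. H n \<cdot> to_stage X n = h"
    by metis
  have kills: "k \<cdot> a = ZeroArr T (stage X n) Z"
    if a: "a \<in> Hom T (stage X n) Y" "a \<cdot> to_stage X n = ZeroArr T X Y" for a n
  proof (cases n)
    case 0
    then have "a \<in> Hom T X Y" "a \<cdot> Ide T X = ZeroArr T X Y" using a by simp_all
    then have "a = ZeroArr T X Y" using comp_ide_right by metis
    then show ?thesis using comp_zero_right[OF k(2) X] 0 by simp
  next
    case (Suc l)
    then have "n_phantom T \<C> n k" using k(1) by (simp add: infinity_phantoms_def)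
    then show ?thesis by (rule n_phantom_kills_maps_vanishing_on_source[OF X _ k(2) a])
  qed
  have "(k \<cdot> H (Suc n)) \<cdot> step X n = k \<cdot> H n" for n
  proof -
    note j = to_stage_hom[OF X, of n] and s = step_hom[OF X, of n]
    note Hs = comp_hom[OF s H[of "Suc n"]]
    note nHs = neg_hom[OF Hs]
    let ?a = "Add T (H n) (inv\<^bsub>hom_group T (stage X n) Y\<^esub> (H (Suc n) \<cdot> step X n))"
    have "(H (Suc n) \<cdot> step X n) \<cdot> to_stage X n = h"
      by (simp only: comp_assoc[OF j s H] to_stage.simps(2)[symmetric] Hh)
    then have "?a \<cdot> to_stage X n = ZeroArr T X Y"
      by (simp only: comp_add_left[OF j H nHs] comp_neg_left[OF j Hs] Hh add_neg[OF h(2)])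
    then have "k \<cdot> ?a = ZeroArr T (stage X n) Z" by (rule kills[OF add_hom[OF H nHs]])
    then have "Add T (k \<cdot> H n) (inv\<^bsub>hom_group T (stage X n) Z\<^esub> (k \<cdot> (H (Suc n) \<cdot> step X n)))
        = ZeroArr T (stage X n) Z"
      by (simp only: comp_add_right[OF H nHs k(2)] comp_neg_right[OF Hs k(2)])
    then have "k \<cdot> H n = k \<cdot> (H (Suc n) \<cdot> step X n)"
      by (rule eq_if_diff_zero[OF comp_hom[OF H k(2)] comp_hom[OF Hs k(2)]])
    then show ?thesis by (simp only: comp_assoc[OF s H k(2)])
  qed
  then have "k \<cdot> H 0 = ZeroArr T (stage X 0) Z"
    by (rule compatible_maps_from_tower_zero[OF X comp_hom[OF H k(2)]])
  moreover have "H 0 = h"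
    using Hh[of 0] comp_ide_right[of "H 0" X Y] H[of 0] by simp
  ultimately show ?thesis by simp
qed

end


theorem corollary6p4p8:
  fixes T :: "('o, 'm) triangulated_category"
    and \<kappa> \<alpha> :: "'u rel"
    and \<C> :: "'o set"
  assumes "inaccessible \<kappa>"
    and "small_regular_cardinal \<kappa> \<alpha>"
    and "triangulated_category T"
    and "locally_small T \<kappa>"
    and "has_coproducts T \<kappa>"
    and "well_generated T \<kappa>"
    and "\<exists>X\<in>Obj T. \<not> zero_obj T X"
    and "\<C> \<subseteq> compact_objects T \<kappa> \<alpha>"
    and "\<exists>C\<in>\<C>. \<not> zero_obj T C"
    and "essentially_small T \<kappa> \<C>"
    and "closed_under_susp T \<C>"
    and "closed_under_desusp T \<C>"
    and "closed_under_coproducts T \<alpha> \<C>"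
    and "generates T \<C>"
    and "perfect T \<kappa> \<C>"
  shows "ideal T (infinity_phantoms T \<C>) \<and>
    (\<forall>X Y Z h k. h \<in> infinity_phantoms T \<C> \<inter> Hom T X Y \<longrightarrow>
       k \<in> infinity_phantoms T \<C> \<inter> Hom T Y Z \<longrightarrow> k \<cdot>\<^bsub>T\<^esub> h = ZeroArr T X Z)"
proof -
  interpret triangulated_category T by fact
  interpret perfect_generators T \<kappa> \<C>
    by unfold_locales fact+
  show ?thesis
    using ideal_infinity_phantoms infinity_phantoms_square_zero by blast
qed

end
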